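(* Let $r\in\,]0,1[$ and let $M=BCBABA$. The collision pattern $\mathfrak{ababcb}$ has self-similar initial data if and only if $r<5-2\sqrt6$. In that case, these self-similar initial data can (up to multiplying $p(0)$ and $q(0)$ by positive scalars) be explicitly written as $$q(0)=\begin{pmatrix} -1 \\ u \\ v \end{pmatrix},\qquad p(0)=\begin{pmatrix} 1 \\ 0 \\ x \end{pmatrix},$$ where $$u=\frac{r(16\lambda-r^4+8r^3+2r^2+8r-1)}{2(r+1)(-r^3+6r^2-r+4\lambda)},$$ $$v=-\frac{\lambda(64\lambda-r^6+10r^5-23r^4+44r^3+r^2+42r-9)+r^2(20r^4-32r^3+8r^2+4)}{4(r+1)^2(-r^3+6r^2-r+4\lambda)},$$ $$x=\frac{a-d+\sqrt{(a-d)^2+4bc}}{2c}.$$ Here $\lambda$ is either the largest or the smallest (positive) real eigenvalue of $M$, and $a,b,c,d$ are given by $$a=-64r^2(r^4-8r^3-2r^2-8r+1)\lambda+1024r^6,$$ $$b=256r^2(r^2-6r+1)\lambda^2-4r^2(r-1)^2(r-3)^2(r^4-8r^3-2r^2-8r+1)\lambda+64r^6(r^4-8r^3+18r^2+5),$$ $$c=16(r-1)^2(r+1)^2(r^2-10r+1)\lambda,$$ $$d=-64(r^4-8r^3-2r^2-8r+1)\lambda^2+(r^{10}-18r^9+101r^8-216r^7+66r^6+372r^5+594r^4-24r^3+253r^2-114r+9)\lambda.$$ However, for $r$ in the interval $]0,5-2\sqrt6[$, these self-similar initial data are not stable.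
   Context: **Particle system.** Four identical point particles move on $\mathbb{R}$ with positions $x_1\le x_2\le x_3\le x_4$ and velocities $v_1,\dots,v_4$. Set $p_i=x_{i+1}-x_i\ge 0$ and $q_i=v_{i+1}-v_i$ for $i=1,2,3$, $p=(p_1,p_2,p_3)$, $q=(q_1,q_2,q_3)$. Between collisions $q$ is constant and $p$ evolves by $\dot p=q$. When $p_i$ reaches $0$, particles $i$ and $i+1$ collide inelastically with fixed restitution coefficient $r\in\,]0,1[$: $v_i'+v_{i+1}'=v_i+v_{i+1}$ and $v_i'-v_{i+1}'=-r(v_i-v_{i+1})$, the other velocities being unchanged. In terms of $q$, the post-collisional vector is $Kq$, where $K$ is one of $$A=\begin{pmatrix}-r&0&0\\ \frac{1+r}{2}&1&0\\ 0&0&1\end{pmatrix},\quad B=\begin{pmatrix}1&\frac{1+r}{2}&0\\ 0&-r&0\\ 0&\frac{1+r}{2}&1\end{pmatrix},\quad C=\begin{pmatrix}1&0&0\\ 0&1&\frac{1+r}{2}\\ 0&0&-r\end{pmatrix},$$ $K=A$ if $p_1=0$ (collision of type $\mathfrak a$), $K=B$ if $p_2=0$ (type $\mathfrak b$), $K=C$ if $p_3=0$ (type $\mathfrak c$). Types $\mathfrak a$ and $\mathfrak c$ may occur simultaneously ($AC=CA$). The dynamics is not defined when $p_1=p_2=0$ or $p_2=p_3=0$ (triple collision). At collision times, $q$ denotes the post-collisional value. **Collision sequences.** An initial datum $(p(0),q(0))$ generates a collision sequence $(c_1,c_2,\dots)$, $c_i\in\{\mathfrak a,\mathfrak b,\mathfrak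 c\}$, if the successive collisions at times $0<t_1\le t_2\le\dots$ are of these types in this order (interchanging $\mathfrak a$ and $\mathfrak c$ is allowed when they are simultaneous). The pattern $\mathfrak{ababcb}$ is the one in which the first six collisions are $\mathfrak a,\mathfrak b,\mathfrak a,\mathfrak b,\mathfrak c,\mathfrak b$ in this order, this block being repeated periodically. **Self-similar data.** Initial data are taken immediately after a collision of type $\mathfrak b$, so $p_2(0)=0$ and $q_2(0)>0$. Such a datum $(p(0),q(0))$ is a self-similar initial datum for the pattern $\mathfrak{ababcb}$ if it generates this pattern and, with $t_6$ the time of the sixth collision, there are scalars $\lambda,\mu$ with $q(t_6)=\lambda q(0)$ and $p(t_6)=\mu p(0)$. Multiplying $p(0)$ by a positive scalar, or $q(0)$ by a positive scalar, preserves the order of collisions. **Stability.** A self-similar initial datum for the pattern is stable if there is a neighbourhood of it, among the initial data with $p_2(0)=0$, all of whose elements generate the infinite periodic repetition of $\mathfrak{ababcb}$; it is not stable if every such neighbourhood contains an initial datum which does not generate this infinite periodic sequence (it generates eventually some other sequence). *)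

theory Defs
  imports "HOL-Analysis.Analysis"
begin

text \<open>
  The state of the particle system is a pair of vectors: the gaps p and the relative
  velocities q between neighbouring particles.
\<close>

datatype collision = ColA | ColB | ColC

fun gap_index :: "collision \<Rightarrow> 3" where
  "gap_index ColA = 1"
| "gap_index ColB = 2"
| "gap_index ColC = 3"

definition mat_A :: "real \<Rightarrow> real^3^3" where
  "mat_A r = vector [vector [-r, 0, 0],
                     vector [(1 + r) / 2, 1, 0],
                     vector [0, 0, 1]]"

definition mat_B :: "real \<Rightarrow> real^3^3" where
  "mat_B r = vector [vector [1, (1 + r) / 2, 0],
                     vector [0, -r, 0],
                     vector [0, (1 + r) / 2, 1]]"

definition mat_C :: "real \<Rightarrow> real^3^3" where
  "mat_C r = vector [vector [1, 0, 0],
                     vector [0, 1, (1 + r) / 2],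
                     vector [0, 0, -r]]"

fun collision_matrix :: "real \<Rightarrow> collision \<Rightarrow> real^3^3" where
  "collision_matrix r ColA = mat_A r"
| "collision_matrix r ColB = mat_B r"
| "collision_matrix r ColC = mat_C r"

definition triple_collision :: "real^3 \<Rightarrow> bool" where
  "triple_collision p \<longleftrightarrow> (p$1 = 0 \<and> p$2 = 0) \<or> (p$2 = 0 \<and> p$3 = 0)"

text \<open>
  An infinite history: t n is the time of the n-th collision, with t 0 = 0 the initial time,
  P n the gaps at time t n and Q n the relative velocities just after the n-th collision.
  The type of the (n+1)-st collision is cs n.

  Simultaneous collisions of types a and c are two successive collisions with equal times,
  admitted in both orders. The condition that the colliding particles approach each other
  is automatic when t n < t (Suc n); when t n = t (Suc n) it prevents a pair that has just
  collided from colliding again at once.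
\<close>

definition collision_history ::
  "real \<Rightarrow> real^3 \<Rightarrow> real^3 \<Rightarrow> (nat \<Rightarrow> collision)
    \<Rightarrow> (nat \<Rightarrow> real) \<Rightarrow> (nat \<Rightarrow> real^3) \<Rightarrow> (nat \<Rightarrow> real^3) \<Rightarrow> bool" where
  "collision_history r p q cs t P Q \<longleftrightarrow>
     t 0 = 0 \<and> P 0 = p \<and> Q 0 = q \<and> 0 < t 1 \<and>
     (\<forall>n. t n \<le> t (Suc n) \<and>
          (\<forall>s. t n < s \<and> s < t (Suc n) \<longrightarrow> (\<forall>i. 0 < (P n + (s - t n) *\<^sub>R Q n) $ i)) \<and>
          P (Suc n) = P n + (t (Suc n) - t n) *\<^sub>R Q n \<and>
          (\<forall>i. 0 \<le> P (Suc n) $ i) \<and> \<not> triple_collision (P (Suc n)) \<and>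
          P (Suc n) $ gap_index (cs n) = 0 \<and> Q n $ gap_index (cs n) < 0 \<and>
          Q (Suc n) = collision_matrix r (cs n) *v Q n)"

definition generates :: "real \<Rightarrow> real^3 \<Rightarrow> real^3 \<Rightarrow> (nat \<Rightarrow> collision) \<Rightarrow> bool" where
  "generates r p q cs \<longleftrightarrow> (\<exists>t P Q. collision_history r p q cs t P Q)"

definition initial_datum :: "real^3 \<Rightarrow> real^3 \<Rightarrow> bool" where
  "initial_datum p q \<longleftrightarrow>
     (\<forall>i. 0 \<le> p $ i) \<and> p $ 2 = 0 \<and> \<not> triple_collision p \<and> 0 < q $ 2"

definition ababcb :: "nat \<Rightarrow> collision" where
  "ababcb n = [ColA, ColB, ColA, ColB, ColC, ColB] ! (n mod 6)"

definition self_similar_datum :: "real \<Rightarrow> real^3 \<Rightarrow> real^3 \<Rightarrow> bool" where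
  "self_similar_datum r p q \<longleftrightarrow>
     initial_datum p q \<and>
     (\<exists>t P Q. collision_history r p q ababcb t P Q \<and>
              (\<exists>l. Q 6 = l *\<^sub>R q) \<and> (\<exists>m. P 6 = m *\<^sub>R p))"

definition stable_datum :: "real \<Rightarrow> real^3 \<Rightarrow> real^3 \<Rightarrow> bool" where
  "stable_datum r p q \<longleftrightarrow>
     (\<exists>U. open U \<and> (p, q) \<in> U \<and>
          (\<forall>p' q'. (p', q') \<in> U \<and> initial_datum p' q' \<longrightarrow> generates r p' q' ababcb))"

definition mat_M :: "real \<Rightarrow> real^3^3" where
  "mat_M r = mat_B r ** mat_C r ** mat_B r ** mat_A r ** mat_B r ** mat_A r"

definition real_eigenvalue :: "real^'n^'n \<Rightarrow> real \<Rightarrow> bool" where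
  "real_eigenvalue T l \<longleftrightarrow> (\<exists>w. w \<noteq> 0 \<and> T *v w = l *\<^sub>R w)"

definition largest_real_eigenvalue :: "real^'n^'n \<Rightarrow> real \<Rightarrow> bool" where
  "largest_real_eigenvalue T l \<longleftrightarrow>
     real_eigenvalue T l \<and> (\<forall>m. real_eigenvalue T m \<longrightarrow> m \<le> l)"

definition smallest_real_eigenvalue :: "real^'n^'n \<Rightarrow> real \<Rightarrow> bool" where
  "smallest_real_eigenvalue T l \<longleftrightarrow>
     real_eigenvalue T l \<and> (\<forall>m. real_eigenvalue T m \<longrightarrow> l \<le> m)"

definition coeff_u :: "real \<Rightarrow> real \<Rightarrow> real" where
  "coeff_u r l =
     r * (16*l - r^4 + 8*r^3 + 2*r^2 + 8*r - 1)
     / (2 * (r + 1) * (-(r^3) + 6*r^2 - r + 4*l))"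

definition coeff_v :: "real \<Rightarrow> real \<Rightarrow> real" where
  "coeff_v r l =
     - ((l * (64*l - r^6 + 10*r^5 - 23*r^4 + 44*r^3 + r^2 + 42*r - 9)
         + r^2 * (20*r^4 - 32*r^3 + 8*r^2 + 4))
        / (4 * (r + 1)^2 * (-(r^3) + 6*r^2 - r + 4*l)))"

definition coeff_a :: "real \<Rightarrow> real \<Rightarrow> real" where
  "coeff_a r l = - 64 * r^2 * (r^4 - 8*r^3 - 2*r^2 - 8*r + 1) * l + 1024 * r^6"

definition coeff_b :: "real \<Rightarrow> real \<Rightarrow> real" where
  "coeff_b r l =
     256 * r^2 * (r^2 - 6*r + 1) * l^2
     - 4 * r^2 * (r - 1)^2 * (r - 3)^2 * (r^4 - 8*r^3 - 2*r^2 - 8*r + 1) * l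
     + 64 * r^6 * (r^4 - 8*r^3 + 18*r^2 + 5)"

definition coeff_c :: "real \<Rightarrow> real \<Rightarrow> real" where
  "coeff_c r l = 16 * (r - 1)^2 * (r + 1)^2 * (r^2 - 10*r + 1) * l"

definition coeff_d :: "real \<Rightarrow> real \<Rightarrow> real" where
  "coeff_d r l =
     - 64 * (r^4 - 8*r^3 - 2*r^2 - 8*r + 1) * l^2
     + (r^10 - 18*r^9 + 101*r^8 - 216*r^7 + 66*r^6 + 372*r^5 + 594*r^4
        - 24*r^3 + 253*r^2 - 114*r + 9) * l"

definition coeff_x :: "real \<Rightarrow> real \<Rightarrow> real" where
  "coeff_x r l =
     (coeff_a r l - coeff_d r l
      + sqrt ((coeff_a r l - coeff_d r l)^2 + 4 * coeff_b r l * coeff_c r l))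
     / (2 * coeff_c r l)"

definition explicit_q :: "real \<Rightarrow> real \<Rightarrow> real^3" where
  "explicit_q r l = vector [-1, coeff_u r l, coeff_v r l]"

definition explicit_p :: "real \<Rightarrow> real \<Rightarrow> real^3" where
  "explicit_p r l = vector [1, 0, coeff_x r l]"

end

theory Submission
  imports Defs
begin

text \<open>
  Why the theorem is true. Subtract the free flight from the gaps, that is, look at the virtual
  gaps P n - t n Q n. A gap vector whose colliding component vanishes is fixed by the collision
  matrix, so the virtual gaps are multiplied by exactly the same matrices as the velocities
  (lemma history_gaps). After one block ababcb with duration T the gaps are therefore
  M (p + T q), and self-similarity says that q is an eigenvector of M for some l > 0 and that
  M p = n p - T l q with n > 0: the plane spanned by p and q is invariant under M.

  Such a plane is the kernel of a left eigenvector of M, whose eigenvalue k is the third root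
  of the characteristic polynomial besides l and n. Solving for this left eigenvector gives the
  ratio x of the third to the first gap as an explicit function gap_ratio of k alone, and x must
  be positive. This one condition decides everything. If r^2 - 10 r + 1 \<le> 0 it is incompatible
  with l, n > 0 (no_admissible_roots). If r^2 - 10 r + 1 > 0, that is, r < 5 - 2 sqrt 6, there
  are three positive eigenvalues S < m < L, and gap_ratio is positive at the middle one only;
  so k = m and {l, n} = {S, L} (admissible_roots). The velocity q is then the eigenvector
  for l, and the formula for x as the root of a quadratic comes from the fact that the values of
  gap_ratio at the two eigenvalues other than l are the two roots (coeff_x_eq).

  Conversely these data do generate the pattern. That the right pair approaches at each collision
  amounts to one window for u (coeff_u_window). The gaps never leave the planes obtained by
  transporting the left eigenvector for m through the block. A vector in such a plane whose gap
  between the pair that has just collided is zero has its two other gaps of the same sign, because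
  the two relevant entries of the normal vector have opposite signs (support_row_separating).

  Neither family is stable, because in each case a faster growing direction is available. If q
  belongs to S, a small component along the eigenvector for L eventually dominates and turns the
  first velocity positive. If q belongs to L, the gaps scale by S in each block, while a
  perturbation of p towards the eigenvector for m scales by m > S and makes a gap negative.
\<close>


section \<open>The characteristic polynomial of the block matrix\<close>

definition trace_M :: "real \<Rightarrow> real" where
  "trace_M r = (r^6 - 10*r^5 + 23*r^4 - 44*r^3 + 15*r^2 - 74*r + 25) / 64"

definition minors_M :: "real \<Rightarrow> real" where
  "minors_M r = (25*r^6 - 74*r^5 + 15*r^4 - 44*r^3 + 23*r^2 - 10*r + 1) / 64"

definition charpoly_M :: "real \<Rightarrow> real \<Rightarrow> real" where
  "charpoly_M r z = z^3 - trace_M r * z^2 + minors_M r * z - r^6"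

lemma mat_M_entries:
  "mat_M r $ 1 $ 1 = (r^6 - 6*r^5 + 7*r^4 - 4*r^3 + 15*r^2 - 22*r + 9) / 64"
  "mat_M r $ 1 $ 2 = (r^5 - 3*r^4 + 10*r^3 - 6*r^2 - 11*r + 9) / 32"
  "mat_M r $ 1 $ 3 = (1 + r)^2 / 4"
  "mat_M r $ 2 $ 1 = - r * (r^5 - 7*r^4 + 10*r^3 + 18*r^2 + 5*r + 5) / 32"
  "mat_M r $ 2 $ 2 = - r * (r^4 - 4*r^3 + 10*r^2 + 4*r + 5) / 16"
  "mat_M r $ 2 $ 3 = - r * (1 + r) / 2"
  "mat_M r $ 3 $ 1 = (r^6 - 10*r^5 + 19*r^4 + 52*r^3 + 7*r^2 - 10*r + 5) / 64"
  "mat_M r $ 3 $ 2 = (r^5 - 7*r^4 + 10*r^3 + 2*r^2 - 11*r + 5) / 32"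
  "mat_M r $ 3 $ 3 = (1 - r)^2 / 4"
  unfolding mat_M_def mat_A_def mat_B_def mat_C_def
  by (simp_all add: matrix_matrix_mult_def sum_3 field_simps power_numeral_reduce)

lemma vec3_eq_iff: "(x :: real^3) = y \<longleftrightarrow> x$1 = y$1 \<and> x$2 = y$2 \<and> x$3 = y$3"
  by (simp add: vec_eq_iff forall_3)

lemma matrix_vector_mult_3:
  "((A :: real^3^3) *v x) $ i = A$i$1 * x$1 + A$i$2 * x$2 + A$i$3 * x$3"
  by (simp add: matrix_vector_mult_def sum_3)

lemma cramer3:
  fixes a b c d e f g h i :: real
  assumes "a*x + b*y + c*z = 0" "d*x + e*y + f*z = 0" "g*x + h*y + i*z = 0"
    and "x \<noteq> 0 \<or> y \<noteq> 0 \<or> z \<noteq> 0"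
  shows "a*(e*i - f*h) - b*(d*i - f*g) + c*(d*h - e*g) = 0" (is "?D = 0")
proof -
  have "?D * x = 0" "?D * y = 0" "?D * z = 0" using assms(1-3) by algebra+
  with assms(4) show ?thesis by auto
qed

lemma charpoly_M_det:
  "(mat_M r $1$1 - z) * ((mat_M r $2$2 - z) * (mat_M r $3$3 - z) - mat_M r $2$3 * mat_M r $3$2)
   - mat_M r $1$2 * (mat_M r $2$1 * (mat_M r $3$3 - z) - mat_M r $2$3 * mat_M r $3$1)
   + mat_M r $1$3 * (mat_M r $2$1 * mat_M r $3$2 - (mat_M r $2$2 - z) * mat_M r $3$1)
   = - charpoly_M r z"
  unfolding charpoly_M_def trace_M_def minors_M_def mat_M_entries
  by (simp add: field_simps power_numeral_reduce)

lemma eigenvalue_imp_root: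
  assumes "real_eigenvalue (mat_M r) z"
  shows "charpoly_M r z = 0"
proof -
  obtain w where w: "w \<noteq> 0" "mat_M r *v w = z *\<^sub>R w"
    using assms unfolding real_eigenvalue_def by blast
  have "(mat_M r $1$1 - z) * w$1 + mat_M r $1$2 * w$2 + mat_M r $1$3 * w$3 = 0"
    "mat_M r $2$1 * w$1 + (mat_M r $2$2 - z) * w$2 + mat_M r $2$3 * w$3 = 0"
    "mat_M r $3$1 * w$1 + mat_M r $3$2 * w$2 + (mat_M r $3$3 - z) * w$3 = 0"
    using w(2) by (simp_all add: vec3_eq_iff matrix_vector_mult_3 algebra_simps)
  from cramer3[OF this] w(1) charpoly_M_det show ?thesis
    by (simp add: vec3_eq_iff)
qed

text \<open>
  The formulas for u and v solve the first two rows of the eigenvector equation identically in z;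
  the third row is a multiple of the characteristic polynomial. The excluded value of z is the pole
  of u.
\<close>

lemma explicit_q_eigenvector:
  assumes "charpoly_M r z = 0" "-(r^3) + 6*r^2 - r + 4*z \<noteq> 0" "r > 0"
  shows "mat_M r *v explicit_q r z = z *\<^sub>R explicit_q r z"
proof -
  define D where "D = -(r^3) + 6*r^2 - r + 4*z"
  define q where "q = explicit_q r z"
  define V where "V = 4 * (r + 1)^2 * D"
  have V: "V \<noteq> 0" using assms by (simp add: V_def D_def)
  have q1: "V * q$1 = - V" by (simp add: q_def explicit_q_def)
  have q2: "V * q$2 = 2 * (r + 1) * (r * (16*z - r^4 + 8*r^3 + 2*r^2 + 8*r - 1))"
  proof -
    have "V = 2 * (r + 1) * (2 * (r + 1) * D)" by (simp add: V_def power2_eq_square algebra_simps)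
    thus ?thesis using assms(2,3) unfolding q_def explicit_q_def coeff_u_def D_def[symmetric]
      by simp
  qed
  have q3: "V * q$3 = - (z * (64*z - r^6 + 10*r^5 - 23*r^4 + 44*r^3 + r^2 + 42*r - 9)
         + r^2 * (20*r^4 - 32*r^3 + 8*r^2 + 4))"
    using V unfolding q_def explicit_q_def coeff_v_def D_def[symmetric] V_def[symmetric]
    by simp
  have "V * (mat_M r *v q) $ 1 - z * (V * q$1) = 0"
    unfolding matrix_vector_mult_3 distrib_left mult.left_commute[of V] q1 q2 q3
    unfolding mat_M_entries V_def D_def
    by (simp add: field_simps power_numeral_reduce)
  moreover have "V * (mat_M r *v q) $ 2 - z * (V * q$2) = 0"
    unfolding matrix_vector_mult_3 distrib_left mult.left_commute[of V] q1 q2 q3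
    unfolding mat_M_entries V_def D_def
    by (simp add: field_simps power_numeral_reduce)
  moreover have "V * (mat_M r *v q) $ 3 - z * (V * q$3) = 64 * charpoly_M r z"
    unfolding matrix_vector_mult_3 distrib_left mult.left_commute[of V] q1 q2 q3
    unfolding mat_M_entries V_def D_def charpoly_M_def trace_M_def minors_M_def
    by (simp add: field_simps power_numeral_reduce)
  ultimately show ?thesis
    using V assms(1) unfolding vec3_eq_iff q_def[symmetric]
    by (simp add: mult.left_commute[of z])
qed

text \<open>
  The vector (-x, y, 1) annihilates the invariant plane spanned by (1, 0, x) and (-1, u, v), so it
  is a left eigenvector. The trace shows that its eigenvalue is the remaining root of the
  characteristic polynomial; this includes the case l = m, in which p may be only a generalized eigenvector.
\<close>

lemma third_eigenvalue:
  fixes A :: "real^3^3"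
  assumes q: "A *v vector [-1, u, v] = l *\<^sub>R vector [-1, u, v]"
    and p: "A *v vector [1, 0, x] = m *\<^sub>R vector [1, 0, x] + k *\<^sub>R vector [-1, u, v]"
    and u: "u \<noteq> 0"
  obtains n y where
    "- x * A$1$1 + y * A$2$1 + A$3$1 = - n * x"
    "- x * A$1$2 + y * A$2$2 + A$3$2 = n * y"
    "- x * A$1$3 + y * A$2$3 + A$3$3 = n"
    "A$1$1 + A$2$2 + A$3$3 = l + m + n"
proof
  define y where "y = - (x + v) / u"
  define n where "n = - x * A$1$3 + y * A$2$3 + A$3$3"
  have uy: "u * y = - (x + v)" using u by (simp add: y_def)
  have e: "- A$1$1 + A$1$2 * u + A$1$3 * v = - l" "- A$2$1 + A$2$2 * u + A$2$3 * v = l * u"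
     "- A$3$1 + A$3$2 * u + A$3$3 * v = l * v"
     "A$1$1 + A$1$3 * x = m - k" "A$2$1 + A$2$3 * x = k * u" "A$3$1 + A$3$3 * x = m * x + k * v"
    using q p by (simp_all add: vec3_eq_iff matrix_vector_mult_3)
  show 1: "- x * A$1$1 + y * A$2$1 + A$3$1 = - n * x"
    using e uy unfolding n_def by algebra
  have "u * (- x * A$1$2 + y * A$2$2 + A$3$2) = u * (n * y)"
    using e uy unfolding n_def by algebra
  thus "- x * A$1$2 + y * A$2$2 + A$3$2 = n * y" using u by simp
  show "- x * A$1$3 + y * A$2$3 + A$3$3 = n" by (simp add: n_def)
  have "u * (A$1$1 + A$2$2 + A$3$3) = u * (l + m + n)"
    using e uy unfolding n_def by algebra
  thus "A$1$1 + A$2$2 + A$3$3 = l + m + n" using u by simp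
qed

text \<open>
  Together with the trace and one root this gives all Vieta relations, with multiplicities, even if
  l and m coincide.
\<close>

lemma third_eigenvalue_minors:
  fixes A :: "real^3^3"
  assumes q: "A *v vector [-1, u, v] = l *\<^sub>R vector [-1, u, v]"
    and p: "A *v vector [1, 0, x] = m *\<^sub>R vector [1, 0, x] + k *\<^sub>R vector [-1, u, v]"
    and u: "u \<noteq> 0" and t: "A$1$1 + A$2$2 + A$3$3 = l + m + n"
  shows "A$1$1 * A$2$2 - A$1$2 * A$2$1 + (A$1$1 * A$3$3 - A$1$3 * A$3$1)
    + (A$2$2 * A$3$3 - A$2$3 * A$3$2) = l*m + m*n + n*l"
proof -
  define a b c d e f g h i where "a = A$1$1" and "b = A$1$2" and "c = A$1$3"
    and "d = A$2$1" and "e = A$2$2" and "f = A$2$3" and "g = A$3$1" and "h = A$3$2" and "i = A$3$3"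
  note defs = a_def b_def c_def d_def e_def f_def g_def h_def i_def
  have n: "n = a + e + i - l - m" using t by (simp add: defs)
  have 1: "u * b = a - v * c - l" "u * e = d - v * f + l * u" "u * h = g - v * i + l * v"
    and 2: "a = m - k - x * c" "d = k * u - x * f" "g = m * x + k * v - x * i"
    using q p by (simp_all add: vec3_eq_iff matrix_vector_mult_3 defs algebra_simps)
  have "u * (a * e - b * d + (a * i - c * g) + (e * i - f * h))
      = a * (u * e) - (u * b) * d + u * (a * i - c * g) + ((u * e) * i - f * (u * h))"
    by (simp add: algebra_simps)
  also have "\<dots> = l * (m * u) + (l + m) * (u * a + u * e + u * i - u * l - u * m)"
    unfolding 1 unfolding 2 by (simp add: algebra_simps)
  also have "\<dots> = u * (l*m + m*n + n*l)" unfolding n by (simp add: algebra_simps)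
  finally show ?thesis using u unfolding defs by simp
qed

lemma mat_M_trace_minors:
  "mat_M r $1$1 + mat_M r $2$2 + mat_M r $3$3 = trace_M r"
  "mat_M r $1$1 * mat_M r $2$2 - mat_M r $1$2 * mat_M r $2$1
    + (mat_M r $1$1 * mat_M r $3$3 - mat_M r $1$3 * mat_M r $3$1)
    + (mat_M r $2$2 * mat_M r $3$3 - mat_M r $2$3 * mat_M r $3$2) = minors_M r"
  unfolding mat_M_entries trace_M_def minors_M_def
  by (simp_all add: field_simps power_numeral_reduce)

text \<open>
  The third column equation and the first minus (1 + r) / 2 times the second are linear in y with
  coefficients free of x; eliminating y between them leaves a relation between x and n that is linear
  in x.
\<close>

lemma left_eigenvector_gap:
  assumes r: "r > 0"
    and e: "- x * mat_M r $1$1 + y * mat_M r $2$1 + mat_M r $3$1 = - n * x"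
    "- x * mat_M r $1$2 + y * mat_M r $2$2 + mat_M r $3$2 = n * y"
    "- x * mat_M r $1$3 + y * mat_M r $2$3 + mat_M r $3$3 = n"
  shows "x * (1 - r)^2 * (n - r^2) = n * (1 - r^2) * (1 - r)^2 - 4 * (n^2 - r^4)"
proof -
  define s where "s = (1 + r) / 2"
  have "(mat_M r $2$1 - s * mat_M r $2$2 + s * n)
        * (- x * mat_M r $1$3 + y * mat_M r $2$3 + mat_M r $3$3 - n)
      - mat_M r $2$3
        * ((- x * mat_M r $1$1 + y * mat_M r $2$1 + mat_M r $3$1 + n * x)
            - s * (- x * mat_M r $1$2 + y * mat_M r $2$2 + mat_M r $3$2 - n * y))
      = - (1 + r) / 8 *
        (x * (1 - r)^2 * (n - r^2) - (n * (1 - r^2) * (1 - r)^2 - 4 * (n^2 - r^4)))"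
    unfolding mat_M_entries s_def by (simp add: field_simps power_numeral_reduce)
  with e r show ?thesis by simp
qed

section \<open>Location of the eigenvalues\<close>

text \<open>
  The smaller root is 5 - 2 sqrt 6; it is the only root below 1.
\<close>

definition threshold :: "real \<Rightarrow> real" where "threshold r = r^2 - 10*r + 1"
text \<open>
  As a function of the eigenvalue, the coefficient u is a quotient of two linear polynomials. These
  are its zero and its pole; for r < 5 - 2 sqrt 6 they separate the eigenvalues.
\<close>

definition u_zero :: "real \<Rightarrow> real" where "u_zero r = (r^4 - 8*r^3 - 2*r^2 - 8*r + 1) / 16"
definition u_pole :: "real \<Rightarrow> real" where "u_pole r = r * (r^2 - 6*r + 1) / 4"

lemma threshold_pos_iff:
  assumes "0 < r" "r < 1"
  shows "0 < threshold r \<longleftrightarrow> r < 5 - 2 * sqrt 6"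
proof -
  have 1: "threshold r = (5 - r)^2 - 24" by (simp add: threshold_def power2_eq_square algebra_simps)
  have 2: "(2 * sqrt 6)^2 = (24::real)" by (simp add: power_mult_distrib)
  have "(5 - r)^2 \<le> (2 * sqrt 6)^2 \<longleftrightarrow> 5 - r \<le> 2 * sqrt 6"
    using assms by (intro power_mono_iff) auto
  thus ?thesis unfolding 1 2 by linarith
qed

text \<open>
  The rational bound lies just above 5 - 2 sqrt 6 = 0.10102...
\<close>

lemma threshold_pos_imp_small:
  assumes "0 < r" "r < 1" "0 < threshold r"
  shows "r < 1011/10000"
proof (rule ccontr)
  assume "\<not> ?thesis"
  hence ge: "r \<ge> 1011/10000" by simp
  hence "(r - 1011/10000) * (1 - r) \<ge> 0" using assms by simp
  moreover have "(r - 1011/10000) * (1 - r) = 11011/10000 * r - r^2 - 1011/10000"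
    by (simp add: power2_eq_square field_simps)
  ultimately show False using assms ge unfolding threshold_def by linarith
qed

text \<open>
  At the three points u_zero, u_pole and r^2 the characteristic polynomial has the factor
  r^2 - 10 r + 1; this is where the threshold 5 - 2 sqrt 6 comes from.
\<close>

lemma charpoly_at_u_zero:
  "charpoly_M r (u_zero r) =
     (1 - r)^4 * (1 + r)^3 * threshold r * (- (r^5) + 15*r^4 - 66*r^3 + 86*r^2 + 35*r - 5) / 16384"
  unfolding charpoly_M_def u_zero_def threshold_def trace_M_def minors_M_def
  by (simp add: field_simps power_numeral_reduce)

lemma charpoly_at_u_pole:
  "charpoly_M r (u_pole r) =
     r * (1 - r)^4 * threshold r * (- (r^5) + 8*r^4 - 22*r^3 + 76*r^2 - 33*r + 4) / 1024"
  unfolding charpoly_M_def u_pole_def threshold_def trace_M_def minors_M_def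
  by (simp add: field_simps power_numeral_reduce)

lemma charpoly_at_r_squared:
  "charpoly_M r (r^2) = r^2 * (1 - r)^3 * (1 + r)^3 * threshold r / 64"
  unfolding charpoly_M_def threshold_def trace_M_def minors_M_def
  by (simp add: field_simps power_numeral_reduce)

text \<open>
  The relations follow by forming divided differences twice.
\<close>

lemma vieta:
  assumes "charpoly_M r a = 0" "charpoly_M r b = 0" "charpoly_M r c = 0" "a < b" "b < c"
  shows "trace_M r = a + b + c" "minors_M r = a*b + b*c + c*a" "r^6 = a*b*c"
proof -
  note e = assms(1-3)[unfolded charpoly_M_def]
  have "(a - b) * (a^2 + a*b + b^2 - trace_M r * (a + b) + minors_M r) = 0" using e by algebra
  hence 1: "a^2 + a*b + b^2 - trace_M r * (a + b) + minors_M r = 0" using assms by simp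
  have "(b - c) * (b^2 + b*c + c^2 - trace_M r * (b + c) + minors_M r) = 0" using e by algebra
  hence 2: "b^2 + b*c + c^2 - trace_M r * (b + c) + minors_M r = 0" using assms by simp
  have "(a - c) * (a + b + c - trace_M r) = 0" using 1 2 by algebra
  thus t: "trace_M r = a + b + c" using assms by simp
  show m: "minors_M r = a*b + b*c + c*a" using 1 t by algebra
  show "r^6 = a*b*c" using e(1) t m by algebra
qed

lemma charpoly_factor:
  assumes "trace_M r = a + b + c" "minors_M r = a*b + b*c + c*a" "r^6 = a*b*c"
  shows "charpoly_M r z = (z - a) * (z - b) * (z - c)"
  unfolding charpoly_M_def assms by (simp add: algebra_simps power2_eq_square power3_eq_cube)

locale separated_roots =
  fixes r S m L :: real
  assumes r_pos: "0 < r" and r_less_1: "r < 1" and threshold: "0 < threshold r"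
    and S: "0 < S" "S < u_pole r" and m: "u_pole r < m" "m < u_zero r" and L: "u_zero r < L"
    and roots: "charpoly_M r S = 0" "charpoly_M r m = 0" "charpoly_M r L = 0"

lemma charpoly_isCont: "isCont (charpoly_M r) z"
  unfolding charpoly_M_def by (intro continuous_intros)

lemma charpoly_cont: "continuous_on A (charpoly_M r)"
  by (simp add: charpoly_isCont continuous_at_imp_continuous_on)

text \<open>
  Names for the powers of r, so that linear arithmetic can bound polynomials in r: the powers become
  independent unknowns related only by these inequalities.
\<close>

definition power_chain :: "real \<Rightarrow> real \<Rightarrow> real \<Rightarrow> real \<Rightarrow> real \<Rightarrow> real \<Rightarrow> real \<Rightarrow> bool" where
  "power_chain c r r2 r3 r4 r5 r6 \<longleftrightarrow>
     r^2 = r2 \<and> r^3 = r3 \<and> r^4 = r4 \<and> r^5 = r5 \<and> r^6 = r6 \<and>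
     0 < r2 \<and> 0 < r3 \<and> 0 < r4 \<and> 0 < r5 \<and> 0 < r6 \<and>
     r2 \<le> c * r \<and> r3 \<le> c * r2 \<and> r4 \<le> c * r3 \<and> r5 \<le> c * r4 \<and> r6 \<le> c * r5"

lemma power_chain_exists:
  assumes "0 < r" "r \<le> c"
  shows "\<exists>r2 r3 r4 r5 r6. power_chain c r r2 r3 r4 r5 r6"
proof -
  have "power_chain c r (r * r) (r * (r * r)) (r * (r * (r * r))) (r * (r * (r * (r * r))))
    (r * (r * (r * (r * (r * r)))))"
    using assms unfolding power_chain_def by (simp add: power_numeral_reduce)
  thus ?thesis by blast
qed

text \<open>
  The characteristic polynomial is negative at 0, positive at u_pole, negative at u_zero and positive
  at 1.
\<close>

lemma separated_roots_exist:
  assumes r: "0 < r" "r < 1" and g: "0 < threshold r"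
  obtains S m L where "separated_roots r S m L"
proof -
  have sm: "r < 1011/10000" by (rule threshold_pos_imp_small[OF r g])
  obtain r2 r3 r4 r5 r6 where "power_chain (1011/10000) r r2 r3 r4 r5 r6"
    using power_chain_exists[OF r(1) less_imp_le[OF sm]] by blast
  note pw = this[unfolded power_chain_def]
  have pos: "0 < u_pole r"
    using g r unfolding u_pole_def threshold_def by (intro divide_pos_pos mult_pos_pos) auto
  have "u_zero r - u_pole r = threshold r * (1 - r)^2 / 16"
    unfolding u_zero_def u_pole_def threshold_def by (simp add: field_simps power_numeral_reduce)
  moreover have "threshold r * (1 - r)^2 / 16 > 0" using g r by simp
  ultimately have lt: "u_pole r < u_zero r" by linarith
  have z0: "charpoly_M r 0 < 0" using r by (simp add: charpoly_M_def)
  have "- (r^5) + 8*r^4 - 22*r^3 + 76*r^2 - 33*r + 4 > 0" using pw sm by linarith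
  hence z1: "charpoly_M r (u_pole r) > 0"
    unfolding charpoly_at_u_pole using g r by (intro divide_pos_pos mult_pos_pos) auto
  have "- (r^5) + 15*r^4 - 66*r^3 + 86*r^2 + 35*r - 5 < 0" using pw sm by linarith
  hence z2: "charpoly_M r (u_zero r) < 0"
    unfolding charpoly_at_u_zero using g r
    by (intro divide_neg_pos mult_pos_neg mult_pos_pos) auto
  have "charpoly_M r 1 = (- 64*r^6 + 24*r^6 - 64*r^5 - 8*r^4 + 8*r^2 + 64*r + 40) / 64"
    unfolding charpoly_M_def trace_M_def minors_M_def by (simp add: field_simps)
  hence z3: "charpoly_M r 1 > 0" using pw sm r(1) by argo
  have lt1: "u_zero r < 1" using pw r(1) unfolding u_zero_def by argo
  obtain S where S: "0 \<le> S" "S \<le> u_pole r" "charpoly_M r S = 0"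
    using IVT'[of "charpoly_M r" 0 0 "u_pole r"] z0 z1 pos charpoly_cont by force
  obtain m where m: "u_pole r \<le> m" "m \<le> u_zero r" "charpoly_M r m = 0"
    using IVT2'[of "charpoly_M r" "u_zero r" 0 "u_pole r"] z1 z2 lt charpoly_cont by force
  obtain L where L: "u_zero r \<le> L" "L \<le> 1" "charpoly_M r L = 0"
    using IVT'[of "charpoly_M r" "u_zero r" 0 1] z2 z3 lt1 charpoly_cont by force
  have "separated_roots r S m L"
    using S m L z0 z1 z2 r g by unfold_locales (auto simp: order_less_le)
  thus thesis by (rule that)
qed

text \<open>
  The quotient of the third and the first gap of a vector with vanishing second gap in the kernel of
  the left eigenvector for the eigenvalue n.
\<close>

definition gap_ratio :: "real \<Rightarrow> real \<Rightarrow> real" where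
  "gap_ratio r n = n * (1 - r^2) / (n - r^2) - 4 * (n + r^2) / (1 - r)^2"

context separated_roots begin

lemma r_small: "r < 1011/10000"
  by (rule threshold_pos_imp_small[OF r_pos r_less_1 threshold])

lemma powers: "\<exists>r2 r3 r4 r5 r6. power_chain (1011/10000) r r2 r3 r4 r5 r6"
  by (rule power_chain_exists[OF r_pos less_imp_le[OF r_small]])

lemma r_squared_bounds: "0 < r^2" "r^2 \<le> 1/90" "r^4 \<le> r^2 / 90"
proof -
  obtain r2 r3 r4 r5 r6 where "power_chain (1011/10000) r r2 r3 r4 r5 r6" using powers by blast
  note pw = this[unfolded power_chain_def]
  show "0 < r^2" using pw by simp
  show "r^2 \<le> 1/90" "r^4 \<le> r^2 / 90" using pw r_small by linarith+
qed

lemma quadratic_pos: "r^2 - 6*r + 1 > 4 * r"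
  using threshold r_pos unfolding threshold_def by simp

lemma r2_less_u_pole: "r^2 < u_pole r"
proof -
  have "u_pole r - r^2 = r * threshold r / 4"
    unfolding u_pole_def threshold_def by (simp add: field_simps power_numeral_reduce)
  moreover have "r * threshold r / 4 > 0" using threshold r_pos by simp
  ultimately show ?thesis by linarith
qed

lemma u_zero_bounds: "0 < u_zero r" "u_zero r < 1/16"
proof -
  show "0 < u_zero r" using m r2_less_u_pole r_squared_bounds by linarith
  obtain r2 r3 r4 r5 r6 where "power_chain (1011/10000) r r2 r3 r4 r5 r6" using powers by blast
  note pw = this[unfolded power_chain_def]
  show "u_zero r < 1/16" using r_pos pw unfolding u_zero_def by argo
qed

lemma order: "S < m" "m < L" "0 < m" "0 < L" "r^2 < m" "r^2 < L"
  using S m L r2_less_u_pole u_zero_bounds by linarith+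

lemmas root_relations = vieta[OF roots order(1,2)]

text \<open>
  The sum of the roots is trace_M, and the two smaller ones are below u_pole and u_zero.
\<close>

lemma L_large: "1/4 < L"
proof -
  obtain r2 r3 r4 r5 r6 where "power_chain (1011/10000) r r2 r3 r4 r5 r6" using powers by blast
  note pw = this[unfolded power_chain_def]
  moreover have "trace_M r - u_zero r - u_pole r \<ge> 1/4"
  proof -
    have "trace_M r - u_zero r - u_pole r
        = (r^6 - 10*r^5 + 19*r^4 - 28*r^3 + 119*r^2 - 58*r + 21) / 64"
      unfolding trace_M_def u_zero_def u_pole_def by (simp add: field_simps power_numeral_reduce)
    moreover have "0 \<le> (r - 1/10)^2" by simp
    hence "0 \<le> r^2 - r / 5 + 1/100" by (simp add: power2_eq_square field_simps)
    ultimately show ?thesis using pw r_small by argo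
  qed
  ultimately show ?thesis using root_relations(1) S m L by linarith
qed

text \<open>
  The product of the roots is r^6, where m exceeds r^2 and L exceeds 1/4.
\<close>

lemma S_small: "S < 4 * r^4" "S < r^2"
proof -
  have "r^2 * (1/4) < m * L"
    using order L_large by (intro mult_strict_mono) auto
  hence "S * (r^2 * (1/4)) < S * (m * L)" using S by simp
  also have "\<dots> = r^6" using root_relations(3) by simp
  finally have "r^2 * S < r^2 * (4 * r^4)" by (simp add: power_numeral_reduce algebra_simps)
  thus 1: "S < 4 * r^4" using r_pos by simp
  show "S < r^2" using 1 r_squared_bounds by linarith
qed

lemma root_cases: "charpoly_M r z = 0 \<longleftrightarrow> z = S \<or> z = m \<or> z = L"
  using charpoly_factor[OF root_relations] by simp

text \<open>
  Since 4 L > 1, the quadratic term 4 L^2 outweighs L (1 - r^2) (1 - r)^2.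
\<close>

lemma gap_ratio_L: "gap_ratio r L < 0"
proof -
  have 1: "(1 - r^2) * (1 - r)^2 \<le> 1 * (1 - r)"
    using r_pos r_less_1 by (intro mult_mono) (auto simp: power2_eq_square mult_left_le)
  have "L * ((1 - r^2) * (1 - r)^2) \<le> L * (1 - r)"
    using 1 order by (intro mult_left_mono) auto
  also have "\<dots> < 4 * (L^2 - r^4)"
  proof -
    have "L * (1/4) < L * L" using L_large by simp
    moreover have "1/4 * r < L * r" using L_large r_pos by simp
    moreover have "4 * r^4 < 1/4 * r"
    proof -
      obtain r2 r3 r4 r5 r6 where "power_chain (1011/10000) r r2 r3 r4 r5 r6"
        using powers by blast
      note pw = this[unfolded power_chain_def]
      show ?thesis using pw r_pos by linarith
    qed
    ultimately show ?thesis by (simp add: power2_eq_square algebra_simps)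
  qed
  finally have "L * (1 - r^2) * (1 - r)^2 < 4 * (L + r^2) * (L - r^2)"
    by (simp add: algebra_simps power_numeral_reduce)
  thus ?thesis using order r_less_1 unfolding gap_ratio_def
    by (simp add: field_simps)
qed

text \<open>
  Here S < r^2, so the quotient is negative, and a positive term is subtracted from it.
\<close>

lemma gap_ratio_S: "gap_ratio r S < 0"
proof -
  have "S * (1 - r^2) / (S - r^2) < 0" using S S_small r_squared_bounds
    by (intro divide_pos_neg mult_pos_pos) auto
  moreover have "4 * (S + r^2) / (1 - r)^2 > 0" using S r_less_1 r_squared_bounds
    by (intro divide_pos_pos mult_pos_pos add_pos_pos) auto
  ultimately show ?thesis unfolding gap_ratio_def by simp
qed

text \<open>
  Here r^2 < m, so the first term is at least 1 - r^2, while m and r^2 are so small that the second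
  term is below 1/2. The bound m (and not just 0) is what the signs of the transported left
  eigenvector require.
\<close>

lemma gap_ratio_m: "m < gap_ratio r m"
proof -
  have "(1 - r^2) * (m - r^2) \<le> (1 - r^2) * m"
    using r_squared_bounds by (intro mult_left_mono) auto
  hence "m * (1 - r^2) / (m - r^2) \<ge> 1 - r^2"
    using order by (simp add: pos_le_divide_eq mult.commute)
  moreover have "4 * (m + r^2) / (1 - r)^2 < 1/2"
  proof -
    have "(1 - r)^2 = 1 - 2 * r + r^2" by (simp add: power2_eq_square algebra_simps)
    hence "(1 - r)^2 \<ge> 3/4" using r_squared_bounds r_small by linarith
    moreover have "4 * (m + r^2) < 3/8" using m u_zero_bounds r_squared_bounds by argo
    moreover have "(1 - r)^2 > 0" using r_less_1 by simp
    ultimately show ?thesis by (simp add: pos_divide_less_eq)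
  qed
  ultimately show ?thesis
    using m u_zero_bounds r_squared_bounds unfolding gap_ratio_def by linarith
qed

lemma gap_ratio_m_pos: "0 < gap_ratio r m"
  using gap_ratio_m order by linarith

end

section \<open>The third eigenvalue decides which data are admissible\<close>

lemma gap_ratio_eqI:
  assumes "r < 1" "n \<noteq> r^2"
    "x * (1 - r)^2 * (n - r^2) = n * (1 - r^2) * (1 - r)^2 - 4 * (n^2 - r^4)"
  shows "x = gap_ratio r n"
proof -
  have nz: "(1 - r)^2 * (n - r^2) \<noteq> 0" using assms by simp
  have "x * ((1 - r)^2 * (n - r^2)) = n * (1 - r^2) * (1 - r)^2 - 4 * (n + r^2) * (n - r^2)"
    using assms(3) by (simp add: algebra_simps power_numeral_reduce)
  also have "\<dots> = gap_ratio r n * ((1 - r)^2 * (n - r^2))"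
    using assms(1,2) unfolding gap_ratio_def by (simp add: field_simps)
  finally show ?thesis using nz by simp
qed

lemma gap_ratio_eq:
  assumes "r < 1" "n \<noteq> r^2"
  shows "gap_ratio r n * (1 - r)^2 * (n - r^2) = n * (1 - r^2) * (1 - r)^2 - 4 * (n^2 - r^4)"
proof -
  have "gap_ratio r n * (1 - r)^2 * (n - r^2)
    = n * (1 - r^2) * (1 - r)^2 - 4 * (n + r^2) * (n - r^2)"
    using assms(1,2) unfolding gap_ratio_def by (simp add: field_simps)
  thus ?thesis by (simp add: algebra_simps power_numeral_reduce)
qed

lemma positive_gap_bound:
  fixes r x n :: real
  assumes "0 < r" "r < 1" "0 < n" "0 < x"
    "x * (1 - r)^2 * (n - r^2) = n * (1 - r^2) * (1 - r)^2 - 4 * (n^2 - r^4)"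
  shows "r^2 < n" "4 * (n^2 - r^4) < n * (1 - r^2) * (1 - r)^2"
proof -
  have r2: "r^2 < 1" using assms by (simp add: power_less_one_iff)
  show n: "r^2 < n"
  proof (rule ccontr)
    assume "\<not> ?thesis"
    hence le: "n \<le> r^2" by simp
    hence "n^2 \<le> (r^2)^2" using assms by (intro power_mono) auto
    hence "n^2 \<le> r^4" by simp
    moreover have "0 < n * (1 - r^2) * (1 - r)^2" using assms r2 by simp
    moreover have "x * (1 - r)^2 * (n - r^2) \<le> 0" using le assms(4) by (simp add: mult_nonneg_nonpos)
    moreover have "4 * (n^2 - r^4) \<le> 0" using \<open>n^2 \<le> r^4\<close> by simp
    ultimately show False using assms(5) by linarith
  qed
  have "0 < x * (1 - r)^2 * (n - r^2)" using assms(1,2,4) n by simp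
  thus "4 * (n^2 - r^4) < n * (1 - r^2) * (1 - r)^2" using assms(5) by linarith
qed

text \<open>
  Hence M cannot have three positive eigenvalues for such r. The cubic 1 - 10 r + 23 r^2 - 29 r^3,
  which majorizes 64 minors_M, is decreasing and already negative at 14/100.
\<close>

lemma minors_M_neg:
  assumes "14/100 \<le> r" "r < 1"
  shows "minors_M r < 0"
proof -
  define d where "d = r - 14/100"
  have d: "0 \<le> d" using assms by (simp add: d_def)
  have q: "- 29 * (r^2 + 14/100 * r + 196/10000) + 23 * (r + 14/100) - 10 < 0"
  proof -
    have "0 \<le> (r - 4/10)^2" by simp
    thus ?thesis using assms by (simp add: power2_eq_square field_simps)
  qed
  have "1 - 10*r + 23*r^2 - 29*r^3
      = d * (- 29 * (r^2 + 14/100 * r + 196/10000) + 23 * (r + 14/100) - 10)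
        + (1 - 10 * (14/100) + 23 * (14/100)^2 - 29 * (14/100)^3)"
    by (simp add: d_def field_simps power_numeral_reduce)
  moreover have "d * (- 29 * (r^2 + 14/100 * r + 196/10000) + 23 * (r + 14/100) - 10) \<le> 0"
    using d q by (intro mult_nonneg_nonpos) auto
  moreover have "1 - 10 * (14/100) + 23 * (14/100)^2 - 29 * (14/100)^3 < (0::real)"
    by (simp add: power_numeral_reduce)
  ultimately have "1 - 10*r + 23*r^2 - 29*r^3 < 0" by linarith
  moreover have "25*r^6 - 74*r^5 + 15*r^4 - 44*r^3 \<le> - 29*r^3"
  proof -
    obtain r2 r3 r4 r5 r6 where "power_chain 1 r r2 r3 r4 r5 r6"
      using power_chain_exists[of r 1] assms by auto
    from this[unfolded power_chain_def] show ?thesis by argo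
  qed
  ultimately show ?thesis unfolding minors_M_def by simp
qed

text \<open>
  All three roots are positive, which forces r < 14/100. The sign of the characteristic polynomial at
  r^2 together with l n k = r^6 and k > r^2 shows that l and n are at most r^2. Then k, being the
  trace minus l + n, is so large that x is negative.
\<close>

lemma no_admissible_roots:
  assumes r: "0 < r" "r < 1" and g: "threshold r \<le> 0"
    and pos: "0 < l" "0 < n" "0 < k" "0 < x"
    and v: "trace_M r = l + n + k" "minors_M r = l*n + n*k + k*l" "r^6 = l*n*k"
    and e: "x * (1 - r)^2 * (k - r^2) = k * (1 - r^2) * (1 - r)^2 - 4 * (k^2 - r^4)"
  shows False
proof -
  note b = positive_gap_bound[OF r pos(3,4) e]
  have r1: "1/10 < r"
  proof (rule ccontr)
    assume "\<not> ?thesis"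
    hence "0 < r * r" "r \<le> 1/10" using r by auto
    thus False using g unfolding threshold_def by (simp add: power2_eq_square)
  qed
  have r2: "r < 14/100"
  proof (rule ccontr)
    assume "\<not> ?thesis"
    hence "minors_M r < 0" using r by (intro minors_M_neg) auto
    moreover have "minors_M r > 0" using pos unfolding v by (simp add: add_pos_pos)
    ultimately show False by simp
  qed
  have ln: "l * n < r^2 * r^2"
  proof -
    have "l * n * r^2 < l * n * k" using b pos by simp
    also have "\<dots> = r^2 * r^2 * r^2" using v(3) by (simp add: power_numeral_reduce)
    finally show ?thesis by (rule mult_right_less_imp_less) simp
  qed
  have "charpoly_M r (r^2) \<le> 0" unfolding charpoly_at_r_squared using r g
    by (intro divide_nonpos_pos mult_nonneg_nonpos mult_nonneg_nonneg) auto
  hence "(r^2 - l) * (r^2 - n) * (r^2 - k) \<le> 0"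
    unfolding charpoly_factor[OF v] .
  hence prod: "(r^2 - l) * (r^2 - n) \<ge> 0" using b(1) by (simp add: mult_le_0_iff zero_le_mult_iff)
  have small: "l \<le> r^2 \<and> n \<le> r^2"
  proof (rule ccontr)
    assume "\<not> ?thesis"
    hence "r^2 \<le> l \<and> r^2 \<le> n" using prod by (auto simp: zero_le_mult_iff)
    hence "r^2 * r^2 \<le> l * n" using pos by (intro mult_mono) auto
    thus False using ln by simp
  qed
  hence k: "trace_M r - 2 * r^2 \<le> k" using v(1) by linarith
  obtain r2 r3 r4 r5 r6 where "power_chain (14/100) r r2 r3 r4 r5 r6"
    using power_chain_exists[OF r(1) less_imp_le[OF r2]] by blast
  note pw = this[unfolded power_chain_def]
  \<comment> \<open>The lower bound 1/6 only serves to absorb the term 4 r^4 / k into 24 r^4.\<close>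
  have "1/6 < trace_M r - 2 * r^2" using pw r2 unfolding trace_M_def by argo
  hence k5: "1/6 < k" using k by simp
  have "(1 - r^2) * (1 - r)^2 = 1 - 2*r + 2*r^3 - r^4"
    by (simp add: algebra_simps power_numeral_reduce)
  hence "(1 - r^2) * (1 - r)^2 + 24 * r^4 < 4 * (trace_M r - 2 * r^2)"
    using pw r1 r2 unfolding trace_M_def by argo
  hence "k * ((1 - r^2) * (1 - r)^2 + 24 * r^4) < k * (4 * k)"
    using k pos by (intro mult_strict_left_mono) auto
  moreover have "1/6 * (24 * r^4) < k * (24 * r^4)" using k5 r
    by (intro mult_strict_right_mono) auto
  ultimately show False using b(2) by (simp add: algebra_simps power2_eq_square)
qed

context separated_roots begin

text \<open>
  The eigenvalue k is one of S, m and L, and the ratio x = gap_ratio r k is positive only for k = m.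
\<close>

lemma admissible_roots:
  assumes pos: "0 < l" "0 < n" "0 < k" "0 < x"
    and v: "trace_M r = l + n + k" "minors_M r = l*n + n*k + k*l" "r^6 = l*n*k"
    and e: "x * (1 - r)^2 * (k - r^2) = k * (1 - r^2) * (1 - r)^2 - 4 * (k^2 - r^4)"
  shows "k = m" "x = gap_ratio r m" "l = S \<or> l = L"
proof -
  note b = positive_gap_bound[OF r_pos r_less_1 pos(3,4) e]
  have "charpoly_M r k = 0" using charpoly_factor[OF v, of k] by simp
  hence "k = S \<or> k = m \<or> k = L" using root_cases by simp
  moreover have x: "x = gap_ratio r k" using gap_ratio_eqI[OF r_less_1 _ e] b by simp
  ultimately show k: "k = m" using pos gap_ratio_S gap_ratio_L by auto
  show "x = gap_ratio r m" using x k by simp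
  have 1: "l + n = S + L" using v(1) root_relations(1) k by simp
  have "(l * n - S * L) * m = 0" using v(3) root_relations(3) unfolding k by algebra
  hence "l * n = S * L" using order by simp
  hence "(l - S) * (l - L) = 0" using 1 by algebra
  thus "l = S \<or> l = L" by simp
qed

lemma coeff_u_eq:
  assumes "z \<noteq> u_pole r"
  shows "coeff_u r z = 2 * r * (z - u_zero r) / ((1 + r) * (z - u_pole r))"
proof -
  have "4 * (z - u_pole r) \<noteq> 0" using assms by simp
  moreover have "- (r^3) + 6 * r^2 - r + 4 * z = 4 * (z - u_pole r)"
    by (simp add: u_pole_def field_simps power_numeral_reduce)
  moreover have "16*z - r^4 + 8*r^3 + 2*r^2 + 8*r - 1 = 16 * (z - u_zero r)"
    by (simp add: u_zero_def field_simps)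
  moreover have "r * (16 * w) / (2 * (r + 1) * (4 * d)) = 2 * r * w / ((1 + r) * d)"
    for w d
  proof -
    have "r * (16 * w) / (2 * (r + 1) * (4 * d)) = (8 * (2 * r * w)) / (8 * ((1 + r) * d))"
      by (simp add: algebra_simps)
    thus ?thesis by (simp only: mult_divide_mult_cancel_left_if) simp
  qed
  ultimately show ?thesis unfolding coeff_u_def by (simp only:)
qed

text \<open>
  Clearing denominators, the difference is linear in z and its coefficients collapse to r^4 and
  u_zero.
\<close>

text \<open>
  The middle eigenvalue lies between the zero and the pole of u.
\<close>

lemma coeff_u_margin:
  assumes "z \<noteq> u_pole r"
  shows "(1 + r) / 2 * (r^2 - 6*r + 1) / (1 - r)^2 - coeff_u r z
     = 8 * (r^4 - z * u_zero r) / ((1 + r) * (1 - r)^2 * (u_pole r - z))"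
proof -
  have "(1 + r)^2 * (r^2 - 6*r + 1) * (u_pole r - z) - 4 * r * (1 - r)^2 * (u_zero r - z)
      = 16 * (r^4 - z * u_zero r)"
    unfolding u_pole_def u_zero_def by (simp add: field_simps power_numeral_reduce)
  hence G: "8 * (r^4 - z * u_zero r) =
    ((1 + r)^2 * (r^2 - 6*r + 1) * (u_pole r - z) - 4 * r * (1 - r)^2 * (u_zero r - z)) / 2"
    by simp
  have u: "coeff_u r z = 2 * r * (u_zero r - z) / ((1 + r) * (u_pole r - z))"
  proof -
    have "2 * r * (z - u_zero r) = - (2 * r * (u_zero r - z))"
      "(1 + r) * (z - u_pole r) = - ((1 + r) * (u_pole r - z))"
      by (simp_all add: algebra_simps)
    thus ?thesis unfolding coeff_u_eq[OF assms] by (simp only: minus_divide_left[symmetric] minus_divide_right[symmetric] minus_minus)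
  qed
  have "g / 2 * e / c - 2 * r * w / (g * d) = ((g^2 * e * d - 4 * r * c * w) / 2) / (g * c * d)"
    if "c \<noteq> 0" "d \<noteq> 0" "g \<noteq> 0" for c d e g w :: real
    using that by (simp add: field_simps power2_eq_square)
  thus ?thesis unfolding u G using assms r_less_1 r_pos by simp
qed

text \<open>
  For S both z - u_zero and z - u_pole are negative, for L both are positive. The upper bound is
  equivalent to the second velocity being negative after the third collision of the block.
\<close>

lemma coeff_u_window:
  assumes "z = S \<or> z = L"
  shows "0 < coeff_u r z" "coeff_u r z < (1 + r) / 2 * (r^2 - 6*r + 1) / (1 - r)^2"
proof -
  have ne: "z \<noteq> u_pole r" using assms S m L by auto
  have D: "0 < (1 + r) * (1 - r)^2" using r_pos r_less_1 by simp
  show "0 < coeff_u r z" using assms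
  proof
    assume z: "z = S"
    have "2 * r * (z - u_zero r) < 0" "(1 + r) * (z - u_pole r) < 0"
      using z S m r_pos by (auto intro!: mult_pos_neg)
    thus ?thesis unfolding coeff_u_eq[OF ne] by (rule divide_neg_neg)
  next
    assume z: "z = L"
    have "2 * r * (z - u_zero r) > 0" "(1 + r) * (z - u_pole r) > 0"
      using z L m r_pos by auto
    thus ?thesis unfolding coeff_u_eq[OF ne] by (rule divide_pos_pos)
  qed
  have "0 < 8 * (r^4 - z * u_zero r) / ((1 + r) * (1 - r)^2 * (u_pole r - z))"
    using assms
  proof
    assume z: "z = S"
    have "S * u_zero r < S * (1/16)" using S u_zero_bounds by simp
    moreover have "0 < r^4" using r_pos by simp
    ultimately have "S * u_zero r < r^4" using S_small(1) by argo
    thus ?thesis using z S D by simp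
  next
    assume z: "z = L"
    have "1/4 * r^2 < L * u_zero r"
      using L_large u_zero_bounds r2_less_u_pole m by (intro mult_strict_mono) auto
    hence "r^4 < L * u_zero r" using r_squared_bounds by linarith
    moreover have "(1 + r) * (1 - r)^2 * (u_pole r - L) < 0" using D m L by (simp add: mult_pos_neg)
    ultimately show ?thesis using z by (simp add: divide_neg_neg)
  qed
  thus "coeff_u r z < (1 + r) / 2 * (r^2 - 6*r + 1) / (1 - r)^2"
    using coeff_u_margin[OF ne] by simp
qed

lemma coeff_u_m: "coeff_u r m < 0"
proof -
  have "m \<noteq> u_pole r" using m by simp
  from coeff_u_eq[OF this] show ?thesis using m r_pos by (simp add: divide_neg_pos mult_pos_neg)
qed

end

section \<open>The gap ratio as a root of the explicit quadratic\<close>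

text \<open>
  Vieta for the quadratic c x^2 - (a - d) x - b, freed from denominators: N k / ((1 - r)^2 (k - r^2))
  is gap_ratio r k, and m, n are the eigenvalues other than z. Both sides are symmetric in m and n,
  hence polynomials in r and z modulo the characteristic polynomial. To keep these small, c is
  replaced by a multiple of z (r^2 - z) (m - r^2) (n - r^2), which is possible because the
  characteristic polynomial at r^2 factors.
\<close>

lemma coeff_relations:
  assumes r: "0 < r" "r < 1" and z: "charpoly_M r z = 0" and sum: "m + n = trace_M r - z"
    and prod: "m * n = minors_M r - z * (trace_M r - z)"
  defines "N \<equiv> \<lambda>k. k * (1 - r^2) * (1 - r)^2 - 4 * (k^2 - r^4)"
  shows "(coeff_a r z - coeff_d r z) * ((1 - r)^2 * ((m - r^2) * (n - r^2)))
      = coeff_c r z * (N m * (n - r^2) + N n * (m - r^2))" (is ?A)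
    and "- coeff_b r z * ((1 - r)^4 * ((m - r^2) * (n - r^2))) = coeff_c r z * (N m * N n)" (is ?B)
proof -
  define S P where "S = m + n" and "P = m * n"
  have S: "S = trace_M r - z" and P: "P = minors_M r - z * S"
    using sum prod by (simp_all add: S_def P_def)
  have zP: "z * P = r^6"
    using z unfolding P S charpoly_M_def
    by (simp add: algebra_simps power2_eq_square power3_eq_cube)
  define Q where "Q = (m - r^2) * (n - r^2)"
  have Q: "Q = P - r^2 * S + r^4"
    by (simp add: Q_def S_def P_def algebra_simps power_numeral_reduce)
  have sq: "m^2 + n^2 = S^2 - 2 * P" by (simp add: S_def P_def power2_eq_square algebra_simps)
  define e where "e = (1 - r^2) * (1 - r)^2"
  define w where "w = r^2 - z"
  define R where "R = P + r^4 + r^2 * S"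
  define b where "b = 64 * (r^2 - 6*r + 1) * z^2
     - (r - 1)^2 * (r - 3)^2 * (r^4 - 8*r^3 - 2*r^2 - 8*r + 1) * z
     + 16 * r^4 * (r^4 - 8*r^3 + 18*r^2 + 5)"
  have NN: "N m * N n = e^2 * P - 4 * e * S * (P - r^4) + 16 * Q * R"
  proof -
    have "N m * N n = (m * e - 4 * (m^2 - r^4)) * (n * e - 4 * (n^2 - r^4))"
      by (simp add: N_def e_def mult.assoc)
    also have "\<dots> = e^2 * P - 4 * e * S * (P - r^4) + 16 * Q * R"
      unfolding Q R_def S_def P_def by (simp add: algebra_simps power_numeral_reduce)
    finally show ?thesis .
  qed
  have wQ: "64 * (w * Q) = r^2 * (1 - r^2)^3 * threshold r"
  proof -
    have "w * Q = charpoly_M r (r^2) - charpoly_M r z"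
      unfolding Q w_def P S charpoly_M_def by (simp add: algebra_simps power_numeral_reduce)
    also have "\<dots> = r^2 * ((1 - r) * (1 + r))^3 * threshold r / 64"
      using z by (simp add: charpoly_at_r_squared power_mult_distrib)
    also have "(1 - r) * (1 + r) = 1 - r^2" by (simp add: power2_eq_square algebra_simps)
    finally show ?thesis by simp
  qed
  \<comment> \<open>Both this identity and the one called key' below are congruences modulo the characteristic
    polynomial; the factor of the latter is the explicit quotient.\<close>
  have key: "b * (1 - r)^2 + 256 * w * (e * r^2 - 4 * S * w)
      + 64 * threshold r * (1 + r)^2 * (r^4 + z * r^2 + z * S) = 1024 * charpoly_M r z"
    unfolding b_def w_def e_def S threshold_def charpoly_M_def trace_M_def minors_M_def
    by (simp add: field_simps power_numeral_reduce)
  have b: "coeff_b r z = 4 * r^2 * b"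
    unfolding coeff_b_def b_def by (simp add: algebra_simps power_numeral_reduce)
  have c: "coeff_c r z = 16 * (1 - r^2)^2 * threshold r * z"
    unfolding coeff_c_def threshold_def by (simp add: algebra_simps power_numeral_reduce)
  have rr: "(1 - r^2) = (1 - r) * (1 + r)" by (simp add: power2_eq_square algebra_simps)
  define g where "g = r^2 * (1 - r^2)"
  have g: "g \<noteq> 0" using r unfolding g_def rr by simp
  have cg: "coeff_c r z * g = 1024 * z * (w * Q)"
  proof -
    have "coeff_c r z * g = 16 * z * (r^2 * (1 - r^2)^3 * threshold r)"
      unfolding c g_def by (simp add: power_numeral_reduce)
    thus ?thesis by (simp add: wQ[symmetric])
  qed
  have 2: "N m * (n - r^2) + N n * (m - r^2)
    = e * (2 * P - r^2 * S) - 4 * (P * S - r^4 * S - r^2 * (S^2 - 2 * P) + 2 * r^6)"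
    unfolding N_def sq[symmetric] S_def P_def e_def
    by (simp add: algebra_simps power_numeral_reduce)
  have key': "(coeff_a r z - coeff_d r z) * ((1 - r)^2 * (1 - r^2))
      = 1024 * w * (e * (2 * r^4 - z * S) - 4 * (r^4 * S - r^2 * z * S - z * S^2 + 2 * r^6 + 2 * r^4 * z))
        + charpoly_M r z * (4096 * z - 64 * r^6 + 640 * r^5 - 2496 * r^4 + 4864 * r^3 - 9152 * r^2 + 2688 * r - 576)"
    unfolding coeff_a_def coeff_d_def w_def e_def S charpoly_M_def trace_M_def minors_M_def
    by (simp add: field_simps power_numeral_reduce)
  have "g * (coeff_c r z * (N m * (n - r^2) + N n * (m - r^2)))
     = (coeff_c r z * g) * (N m * (n - r^2) + N n * (m - r^2))"
    by (simp only: mult_ac)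
  also have "\<dots> = 1024 * w * Q * (z * (N m * (n - r^2) + N n * (m - r^2)))"
    unfolding cg by (simp only: mult_ac)
  also have "z * (N m * (n - r^2) + N n * (m - r^2)) =
     e * (2 * (z * P) - r^2 * z * S)
      - 4 * ((z * P) * S - r^4 * z * S - r^2 * (z * S^2 - 2 * (z * P)) + 2 * r^6 * z)"
    unfolding 2 by (simp add: algebra_simps)
  also have "\<dots> = r^2 * (e * (2 * r^4 - z * S)
      - 4 * (r^4 * S - r^2 * z * S - z * S^2 + 2 * r^6 + 2 * r^4 * z))"
    unfolding zP by (simp add: algebra_simps power_numeral_reduce)
  also have "1024 * w * Q * \<dots> = Q * r^2 * ((coeff_a r z - coeff_d r z) * ((1 - r)^2 * (1 - r^2)))"
    unfolding key' using z by simp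
  also have "\<dots> = g * ((coeff_a r z - coeff_d r z) * ((1 - r)^2 * Q))"
    unfolding g_def by simp
  finally show ?A using g unfolding Q_def by simp
  have "g * (coeff_c r z * (N m * N n)) = Q * (1024 * (w * (z * (N m * N n))))"
    using cg by (simp add: mult_ac)
  also have "w * (z * (N m * N n))
     = w * e * (e * (z * P) - 4 * S * (z * P - z * r^4)) + 16 * (w * Q) * (z * R)"
    unfolding NN by (simp add: algebra_simps power2_eq_square)
  also have "z * R = r^6 + z * r^4 + r^2 * z * S"
    unfolding R_def using zP by (simp add: algebra_simps)
  also have "1024 * (w * e * (e * (z * P) - 4 * S * (z * P - z * r^4))
       + 16 * (w * Q) * (r^6 + z * r^4 + r^2 * z * S))
     = 4 * r^2 * g * (1 - r)^2 * (256 * w * (e * r^2 - 4 * S * w)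
          + 64 * threshold r * (1 + r)^2 * (r^4 + z * r^2 + z * S))"
  proof -
    have "1024 * (16 * (w * Q) * (r^6 + z * r^4 + r^2 * z * S))
      = 256 * (r^2 * (1 - r^2)^3 * threshold r) * (r^6 + z * r^4 + r^2 * z * S)"
      by (simp add: wQ[symmetric])
    also have "\<dots> = 4 * r^2 * g * (1 - r)^2 * (64 * threshold r * (1 + r)^2 * (r^4 + z * r^2 + z * S))"
      unfolding g_def rr by (simp add: algebra_simps power_numeral_reduce)
    finally have i: "1024 * (16 * (w * Q) * (r^6 + z * r^4 + r^2 * z * S)) = \<dots>" .
    have "1024 * (w * e * (e * r^6 - 4 * S * (r^6 - z * r^4)))
        = 1024 * w * e * (r^4 * (e * r^2 - 4 * S * w))"
      unfolding w_def by (simp add: algebra_simps power_numeral_reduce)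
    also have "\<dots> = 4 * r^2 * g * (1 - r)^2 * (256 * w * (e * r^2 - 4 * S * w))"
    proof -
      have "e * r^4 = r^2 * g * (1 - r)^2" unfolding e_def g_def by (simp add: power_numeral_reduce)
      hence "1024 * w * (e * r^4) * V = 1024 * w * (r^2 * g * (1 - r)^2) * V" for V by simp
      from this[of "e * r^2 - 4 * S * w"] show ?thesis by (simp only: mult_ac)
    qed
    finally show ?thesis using i zP by (simp add: distrib_left)
  qed
  also have "256 * w * (e * r^2 - 4 * S * w)
          + 64 * threshold r * (1 + r)^2 * (r^4 + z * r^2 + z * S) = - (b * (1 - r)^2)"
    using key z by simp
  also have "Q * (4 * r^2 * g * (1 - r)^2 * - (b * (1 - r)^2)) = g * (- coeff_b r z * ((1 - r)^4 * Q))"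
    unfolding b by (simp add: power_numeral_reduce)
  finally have "g * (coeff_c r z * (N m * N n)) = g * (- coeff_b r z * ((1 - r)^4 * Q))" .
  hence "coeff_c r z * (N m * N n) = - coeff_b r z * ((1 - r)^4 * Q)"
    by (rule mult_left_cancel[OF g, THEN iffD1])
  thus ?B unfolding Q_def by simp
qed

context separated_roots begin

text \<open>
  Let n be the third eigenvalue besides z and m. The two roots of the quadratic are gap_ratio r m > 0
  and gap_ratio r n < 0, and c > 0; so the root with the positive sign of the square root is
  gap_ratio r m.
\<close>

lemma coeff_x_eq:
  assumes "z = S \<or> z = L"
  shows "coeff_x r z = gap_ratio r m"
proof -
  obtain n where n: "m + n = trace_M r - z" "m * n = minors_M r - z * (trace_M r - z)"
    "n \<noteq> r^2" "gap_ratio r n < 0" "charpoly_M r z = 0" "0 < z"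
    using assms
  proof
    assume "z = S"
    thus thesis using that[of L] root_relations roots order gap_ratio_L S by (auto simp: algebra_simps power2_eq_square)
  next
    assume "z = L"
    thus thesis using that[of S] root_relations roots order gap_ratio_S S_small by (auto simp: algebra_simps power2_eq_square)
  qed
  define x y where "x = gap_ratio r m" and "y = gap_ratio r n"
  define D where "D = (m - r^2) * (n - r^2)"
  have D: "(1 - r)^2 * D \<noteq> 0" "(1 - r)^4 * D \<noteq> 0" using order n r_less_1 unfolding D_def by auto
  note rel = coeff_relations[OF r_pos r_less_1 n(5,1,2)]
  have m_ne: "m \<noteq> r^2" using order by simp
  have "(coeff_a r z - coeff_d r z) * ((1 - r)^2 * D) = coeff_c r z * (x + y) * ((1 - r)^2 * D)"
    unfolding rel(1)[folded D_def] unfolding gap_ratio_eq[OF r_less_1 m_ne, symmetric]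
      gap_ratio_eq[OF r_less_1 n(3), symmetric] x_def y_def D_def
    by (simp add: algebra_simps)
  hence ad: "coeff_a r z - coeff_d r z = coeff_c r z * (x + y)" using D by simp
  have "- coeff_b r z * ((1 - r)^4 * D) = coeff_c r z * (x * y) * ((1 - r)^4 * D)"
    unfolding rel(2)[folded D_def] unfolding gap_ratio_eq[OF r_less_1 m_ne, symmetric]
      gap_ratio_eq[OF r_less_1 n(3), symmetric] x_def y_def D_def
    by (simp add: power_numeral_reduce)
  hence b: "coeff_b r z = - (coeff_c r z * (x * y))" using D(2) by (metis minus_equation_iff mult_right_cancel)
  have c: "coeff_c r z > 0"
    unfolding coeff_c_def using n(6) threshold r_pos r_less_1 unfolding threshold_def by (intro mult_pos_pos) auto
  have "(coeff_a r z - coeff_d r z)^2 + 4 * coeff_b r z * coeff_c r z = (coeff_c r z * (x - y))^2"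
    unfolding ad b by (simp add: algebra_simps power2_eq_square)
  moreover have "0 \<le> coeff_c r z * (x - y)"
    using c n(4) gap_ratio_m_pos unfolding x_def y_def by simp
  ultimately have "coeff_x r z = (coeff_c r z * (x + y) + coeff_c r z * (x - y)) / (2 * coeff_c r z)"
    unfolding coeff_x_def ad by (simp add: real_sqrt_abs)
  also have "\<dots> = x" using c by (simp add: field_simps)
  finally show ?thesis unfolding x_def .
qed

section \<open>Transporting the left eigenvector through the block\<close>

text \<open>
  The entries that appear when the left eigenvector (-x, row_mid, 1) for m, where x = gap_ratio r m,
  is multiplied from the right by the collision matrices B, C, B, A, B, A of the block: each of the
  first steps creates one new entry, and the last two steps must reproduce m times the eigenvector.
\<close>

definition row_mid :: real where
  "row_mid = ((1 + r) / 2 * (1 - gap_ratio r m) - 2 * (m + r) / (1 + r)) / r"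

definition row_B :: real where
  "row_B = (1 + r) / 2 * (m - gap_ratio r m) - r * (2 * (m + r) / (1 + r))"

definition row_A :: real where
  "row_A = r * gap_ratio r m + (1 + r) / 2 * row_B"

text \<open>
  The last two relations close the cycle. The one for the first entry is the defining equation of
  gap_ratio; the one for the second entry is, after multiplication by the denominator of gap_ratio,
  the characteristic equation of m.
\<close>

lemma row_relations:
  "(1 + r) / 2 * (1 - gap_ratio r m) - r * row_mid = 2 * (m + r) / (1 + r)" (is ?R1)
  "m * row_mid = (1 + r) / 2 * (row_A + m) - r * row_B" (is ?R5)
  "- m * gap_ratio r m = - r * row_A + (1 + r) / 2 * (m * row_mid)" (is ?R6)
proof -
  define s x where "s = (1 + r) / 2" and "x = gap_ratio r m"
  note d = s_def[symmetric] x_def[symmetric]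
  have s: "2 * (m + r) / (1 + r) = (m + r) / s" "s \<noteq> 0" using r_pos by (simp_all add: s_def)
  show ?R1 using r_pos unfolding row_mid_def by simp
  have B: "s * row_B = s^2 * (m - x) - r * (m + r)"
    unfolding row_B_def d s(1) using s(2) by (simp add: field_simps power2_eq_square)
  have M: "r * s * row_mid = s^2 * (1 - x) - (m + r)"
    unfolding row_mid_def d s(1) using s(2) r_pos by (simp add: field_simps power2_eq_square)
  have A: "row_A = r * x + (s^2 * (m - x) - r * (m + r))"
    unfolding row_A_def d B ..
  have "m \<noteq> r^2" using order by simp
  note E = gap_ratio_eq[OF r_less_1 this, folded x_def]
  have "r * (- r * row_A + s * (m * row_mid) + m * x)
      = - (r^2 * row_A) + m * (r * s * row_mid) + m * x * r"
    by (simp add: algebra_simps power2_eq_square)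
  also have "\<dots> = - 1/4 * (x * (1 - r)^2 * (m - r^2) - (m * (1 - r^2) * (1 - r)^2 - 4 * (m^2 - r^4)))"
    unfolding A M unfolding s_def by (simp add: field_simps power_numeral_reduce)
  finally have "- r * row_A + s * (m * row_mid) + m * x = 0" using E r_pos by simp
  thus ?R6 unfolding d by linarith
  define k where "k = (1 - r)^2 * (m - r^2)"
  have k: "k \<noteq> 0" using r_less_1 \<open>m \<noteq> r^2\<close> by (simp add: k_def)
  have "k * (r * s * (s * (row_A + m) - r * row_B - m * row_mid))
      = k * ((s^2 * (row_A + m) - r * (s * row_B)) * r - m * (r * s * row_mid))"
    by (simp add: algebra_simps power2_eq_square)
  also have "\<dots> = - 4 * r * charpoly_M r m
      + (1 + r)^2 * (- (r^3) / 16 + 3 * r^2 / 8 + m / 4 - r / 16) * (x * (1 - r)^2 * (m - r^2) - (m * (1 - r^2) * (1 - r)^2 - 4 * (m^2 - r^4)))"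
    unfolding A M B unfolding k_def s_def charpoly_M_def trace_M_def minors_M_def
    by (simp add: field_simps power_numeral_reduce)
  also have "\<dots> = 0" using E roots by simp
  finally have "s * (row_A + m) - r * row_B - m * row_mid = 0" using k r_pos s(2) by simp
  thus ?R5 unfolding d by linarith
qed

text \<open>
  Up to positive factors, row_B and row_A are sums of negative terms because x > m. For row_mid the
  relations combine to (2 r - s^2) row_mid > 0 with s = (1 + r) / 2, where 2 r < s^2 since
  r^2 - 6 r + 1 > 0.
\<close>

lemma row_signs: "row_mid < 0" "row_B < 0" "row_A < 0"
proof -
  define s x where "s = (1 + r) / 2" and "x = gap_ratio r m"
  note d = s_def[symmetric] x_def[symmetric]
  have s: "0 < s" using r_pos by (simp add: s_def)
  have x: "m < x" "0 < x" using gap_ratio_m gap_ratio_m_pos by (simp_all add: x_def)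
  have ss: "s^2 - r = (1 - r)^2 / 4" by (simp add: s_def field_simps power2_eq_square)
  have nz: "2 * (m + r) / (1 + r) = (m + r) / s" by (simp add: s_def)
  have "s * (m - x) < 0" using s x by (simp add: mult_pos_neg)
  moreover have "0 < r * ((m + r) / s)" using s r_pos order by simp
  ultimately show B: "row_B < 0" unfolding row_B_def d nz by linarith
  have "s * row_B = s^2 * (m - x) - r * (m + r)"
    unfolding row_B_def d nz using s by (simp add: field_simps power2_eq_square)
  hence "row_A = (s^2 - r) * (m - x) - r^2"
    unfolding row_A_def d by (simp add: algebra_simps power2_eq_square)
  moreover have "(s^2 - r) * (m - x) < 0" unfolding ss using x r_less_1 by (intro mult_pos_neg) auto
  ultimately show A: "row_A < 0" by (smt (verit) zero_le_power2)
  have 1: "m * row_mid = s * (row_A + m) - r * row_B"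
    and 2: "r * row_A = m * (x + s * row_mid)"
    using row_relations(2,3) unfolding d by (simp_all add: algebra_simps)
  have 3: "s * row_B = row_A - r * x" unfolding row_A_def d by simp
  have "m * ((r - (s^2 - r)) * row_mid) * s
     = r * s * (m * row_mid) - (s^2 - r) * (m * (s * row_mid))" by (simp add: algebra_simps)
  also have "m * (s * row_mid) = r * row_A - m * x" using 2 by (simp add: algebra_simps)
  also have "r * s * (m * row_mid) = r * (s^2 * (row_A + m) - r * (s * row_B))"
    unfolding 1 by (simp add: algebra_simps power2_eq_square)
  also have "\<dots> - (s^2 - r) * (r * row_A - m * x) = r * s^2 * m + r^3 * x + (s^2 - r) * (m * x)"
    unfolding 3 by (simp add: algebra_simps power2_eq_square power3_eq_cube)
  also have "\<dots> > 0" unfolding ss using r_pos s order x r_less_1 by (simp add: add_pos_pos)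
  finally have "0 < (m * s) * ((r - (s^2 - r)) * row_mid)" by (simp only: mult_ac)
  hence "0 < (r - (s^2 - r)) * row_mid" by (rule zero_less_mult_pos) (use order s in simp)
  moreover have "r - (s^2 - r) < 0" unfolding ss using quadratic_pos r_pos
    by (simp add: power2_eq_square algebra_simps)
  ultimately show "row_mid < 0" by (simp add: zero_less_mult_iff)
qed

end

section \<open>Orbits with a prescribed collision sequence\<close>

definition touching :: "collision \<Rightarrow> real^3 \<Rightarrow> bool" where
  "touching c P \<longleftrightarrow> P $ gap_index c = 0 \<and> (\<forall>i. i \<noteq> gap_index c \<longrightarrow> 0 < P $ i)"

text \<open>
  If h is orthogonal to a vector whose component for c vanishes, opposite signs of the two other
  entries of h force the other two components of the vector to have the same sign.
\<close>

definition separating :: "collision \<Rightarrow> real^3 \<Rightarrow> bool" where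
  "separating c h \<longleftrightarrow>
     (\<forall>i k. i \<noteq> k \<and> i \<noteq> gap_index c \<and> k \<noteq> gap_index c \<longrightarrow> h $ i * h $ k < 0)"

lemma gap_index_eq_iff: "gap_index c = gap_index c' \<longleftrightarrow> c = c'"
  by (cases c; cases c') auto

lemma collision_matrix_fixes:
  assumes "P $ gap_index c = 0"
  shows "collision_matrix r c *v P = P"
  using assms by (cases c) (auto simp: vec3_eq_iff matrix_vector_mult_3 mat_A_def mat_B_def mat_C_def)

lemma collision_reverses: "(collision_matrix r c *v Q) $ gap_index c = - r * Q $ gap_index c"
  by (cases c) (auto simp: matrix_vector_mult_3 mat_A_def mat_B_def mat_C_def)

lemma third_index:
  fixes i j :: 3
  assumes "i \<noteq> j"
  obtains k where "k \<noteq> i" "k \<noteq> j" "UNIV = {i, j, k}"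
proof -
  have "card {i, j} \<noteq> card (UNIV :: 3 set)" using assms by simp
  hence "{i, j} \<noteq> UNIV" by metis
  then obtain k where k: "k \<noteq> i" "k \<noteq> j" by blast
  moreover have "card {i, j, k} = card (UNIV :: 3 set)" using k assms by simp
  hence "{i, j, k} = UNIV" by (intro card_subset_eq) auto
  ultimately show thesis using that by blast
qed

text \<open>
  The pair that has just collided separates, so its gap becomes positive during the flight. The new
  gap vector remains orthogonal to the transported normal vector because it is fixed by the collision
  matrix; its third component then has the same sign.
\<close>

lemma flight_keeps_gaps_positive:
  assumes "c \<noteq> c'" and P: "touching c' P" and Q: "Q $ gap_index c < 0" "0 < Q $ gap_index c'"
    and h: "h \<bullet> P = 0" "h \<bullet> Q = 0" "\<And>x. h' \<bullet> (collision_matrix r c *v x) = h \<bullet> x"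
    and sep: "separating c h'"
  defines "P' \<equiv> P - (P $ gap_index c / Q $ gap_index c) *\<^sub>R Q"
  shows "touching c P'" "h' \<bullet> P' = 0" "h' \<bullet> (collision_matrix r c *v Q) = 0"
proof -
  define i j where "i = gap_index c" and "j = gap_index c'"
  have ij: "i \<noteq> j" using \<open>c \<noteq> c'\<close> by (simp add: i_def j_def gap_index_eq_iff)
  then obtain k where k: "k \<noteq> i" "k \<noteq> j" and U: "UNIV = {i, j, k}" by (rule third_index)
  have Pi: "P' $ i = 0" using Q unfolding P'_def i_def by simp
  have Pj: "0 < P' $ j"
  proof -
    have "0 < P $ i" using P ij unfolding touching_def i_def j_def by simp
    hence "P $ i / Q $ i * Q $ j < 0" using Q unfolding i_def j_def
      by (simp add: mult_neg_pos divide_pos_neg)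
    moreover have "P $ j = 0" using P unfolding touching_def j_def by simp
    ultimately show ?thesis unfolding P'_def i_def by simp
  qed
  have "h' \<bullet> P' = h' \<bullet> (collision_matrix r c *v P')"
    using Pi by (simp add: collision_matrix_fixes i_def)
  also have "\<dots> = h \<bullet> P'" by (rule h(3))
  also have "\<dots> = 0" unfolding P'_def using h(1,2) by (simp add: inner_diff_right)
  finally show hP: "h' \<bullet> P' = 0" .
  have "h' \<bullet> P' = h' $ i * P' $ i + h' $ j * P' $ j + h' $ k * P' $ k"
    unfolding inner_vec_def U using ij k by simp
  hence 1: "h' $ k * P' $ k = - (h' $ j * P' $ j)" using hP Pi by simp
  have 2: "h' $ j * h' $ k < 0" using sep ij k unfolding separating_def i_def by auto
  have "(h' $ k)^2 * P' $ k = h' $ k * (h' $ k * P' $ k)" by (simp add: power2_eq_square)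
  also have "\<dots> = - (h' $ j * h' $ k) * P' $ j" unfolding 1 by simp
  finally have "(h' $ k)^2 * P' $ k = - (h' $ j * h' $ k) * P' $ j" .
  moreover have "0 < - (h' $ j * h' $ k) * P' $ j" using 2 Pj by (intro mult_pos_pos) auto
  ultimately have "0 < (h' $ k)^2 * P' $ k" by simp
  hence "0 < P' $ k" by (simp add: zero_less_mult_iff)
  moreover have "l = i \<or> l = j \<or> l = k" for l using U by blast
  ultimately show "touching c P'" using Pi Pj unfolding touching_def i_def[symmetric] by blast
  show "h' \<bullet> (collision_matrix r c *v Q) = 0" using h by simp
qed

text \<open>
  The orbit that is forced to follow the word cs, whether or not the collisions actually occur in
  this order.
\<close>

primrec velocities :: "real \<Rightarrow> (nat \<Rightarrow> collision) \<Rightarrow> real^3 \<Rightarrow> nat \<Rightarrow> real^3" where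
  "velocities r cs q 0 = q"
| "velocities r cs q (Suc n) = collision_matrix r (cs n) *v velocities r cs q n"

primrec gaps :: "real \<Rightarrow> (nat \<Rightarrow> collision) \<Rightarrow> real^3 \<Rightarrow> real^3 \<Rightarrow> nat \<Rightarrow> real^3" where
  "gaps r cs p q 0 = p"
| "gaps r cs p q (Suc n) = gaps r cs p q n
     - (gaps r cs p q n $ gap_index (cs n) / velocities r cs q n $ gap_index (cs n)) *\<^sub>R velocities r cs q n"

primrec collision_time :: "real \<Rightarrow> (nat \<Rightarrow> collision) \<Rightarrow> real^3 \<Rightarrow> real^3 \<Rightarrow> nat \<Rightarrow> real" where
  "collision_time r cs p q 0 = 0"
| "collision_time r cs p q (Suc n) = collision_time r cs p q n
     - gaps r cs p q n $ gap_index (cs n) / velocities r cs q n $ gap_index (cs n)"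

lemma touching_simps:
  "touching ColA P \<longleftrightarrow> P $ 1 = 0 \<and> 0 < P $ 2 \<and> 0 < P $ 3"
  "touching ColB P \<longleftrightarrow> P $ 2 = 0 \<and> 0 < P $ 1 \<and> 0 < P $ 3"
  "touching ColC P \<longleftrightarrow> P $ 3 = 0 \<and> 0 < P $ 1 \<and> 0 < P $ 2"
  unfolding touching_def forall_3 by auto

lemma touching_not_triple: "touching c P \<Longrightarrow> \<not> triple_collision P"
  unfolding triple_collision_def by (cases c) (auto simp: touching_simps)

lemma touching_nonneg: "touching c P \<Longrightarrow> 0 \<le> P $ i"
  unfolding touching_def by (cases "i = gap_index c") (auto intro: less_imp_le)

text \<open>
  Each gap is positive at one end of every flight: the one that is zero at the start belongs to a
  different pair than the one that is zero at the end. Gaps are affine along the flight, so all are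
  positive in between.
\<close>

lemma history_of_orbit:
  assumes start: "touching c0 p"
    and touch: "\<And>n. touching (cs n) (gaps r cs p q (Suc n))"
    and appr: "\<And>n. velocities r cs q n $ gap_index (cs n) < 0"
    and alt: "c0 \<noteq> cs 0" "\<And>n. cs n \<noteq> cs (Suc n)"
  shows "collision_history r p q cs (collision_time r cs p q) (gaps r cs p q) (velocities r cs q)"
proof -
  define prev where "prev = (\<lambda>n. case n of 0 \<Rightarrow> c0 | Suc k \<Rightarrow> cs k)"
  have T: "touching (prev n) (gaps r cs p q n)" for n
    using start touch by (cases n) (simp_all add: prev_def)
  have ne: "prev n \<noteq> cs n" for n using alt by (cases n) (simp_all add: prev_def)
  define dt where "dt = (\<lambda>n. - gaps r cs p q n $ gap_index (cs n) / velocities r cs q n $ gap_index (cs n))"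
  have dt: "0 < dt n" for n
  proof -
    have "0 < gaps r cs p q n $ gap_index (cs n)"
      using T[of n] ne[of n] unfolding touching_def by (metis gap_index_eq_iff)
    thus ?thesis using appr[of n] unfolding dt_def by (simp add: divide_pos_neg)
  qed
  have t: "collision_time r cs p q (Suc n) = collision_time r cs p q n + dt n" for n by (simp add: dt_def)
  have g: "gaps r cs p q (Suc n) = gaps r cs p q n + dt n *\<^sub>R velocities r cs q n" for n
    by (simp add: dt_def)
  have interior: "0 < (gaps r cs p q n + (s - collision_time r cs p q n) *\<^sub>R velocities r cs q n) $ i"
    if s: "collision_time r cs p q n < s" "s < collision_time r cs p q (Suc n)" for n s i
  proof -
    define a where "a = (s - collision_time r cs p q n) / dt n"
    have a: "0 < a" "a < 1" using s dt[of n] unfolding a_def t by (auto simp: field_simps)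
    have "gaps r cs p q n + (s - collision_time r cs p q n) *\<^sub>R velocities r cs q n
       = (1 - a) *\<^sub>R gaps r cs p q n + a *\<^sub>R gaps r cs p q (Suc n)"
    proof -
      have "s - collision_time r cs p q n = a * dt n" using dt[of n] unfolding a_def by simp
      thus ?thesis unfolding g by (simp add: algebra_simps)
    qed
    hence eq: "(gaps r cs p q n + (s - collision_time r cs p q n) *\<^sub>R velocities r cs q n) $ i
       = (1 - a) * gaps r cs p q n $ i + a * gaps r cs p q (Suc n) $ i" by simp
    have nn: "0 \<le> gaps r cs p q n $ i" "0 \<le> gaps r cs p q (Suc n) $ i"
      using touching_nonneg T touch by blast+
    have "0 < gaps r cs p q n $ i \<or> 0 < gaps r cs p q (Suc n) $ i"
      using T[of n] touch[of n] ne[of n] unfolding touching_def by (metis gap_index_eq_iff)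
    thus ?thesis unfolding eq using a nn
      by (auto intro: add_pos_nonneg add_nonneg_pos)
  qed
  show ?thesis unfolding collision_history_def
  proof (intro conjI allI impI)
    show "0 < collision_time r cs p q 1" using dt[of 0] t[of 0] by simp
  next
    fix n
    show "collision_time r cs p q n \<le> collision_time r cs p q (Suc n)" using dt[of n] t[of n] by simp
    show "0 < (gaps r cs p q n + (s - collision_time r cs p q n) *\<^sub>R velocities r cs q n) $ i"
      if "collision_time r cs p q n < s \<and> s < collision_time r cs p q (Suc n)" for s i
      using interior that by blast
    show "gaps r cs p q (Suc n) = gaps r cs p q n + (collision_time r cs p q (Suc n) - collision_time r cs p q n) *\<^sub>R velocities r cs q n"
      unfolding g t by simp
    show "\<not> triple_collision (gaps r cs p q (Suc n))" using touching_not_triple[OF touch] .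
    show "gaps r cs p q (Suc n) $ gap_index (cs n) = 0" using touch unfolding touching_def by blast
    show "velocities r cs q n $ gap_index (cs n) < 0" by (rule appr)
  next
    fix n i show "0 \<le> gaps r cs p q (Suc n) $ i" using touching_nonneg[OF touch] .
  qed simp_all
qed

text \<open>
  The gap recursion is homogeneous of degree one in the gaps and of degree zero in the velocities.
\<close>

lemma orbit_periodic_scaling:
  assumes per: "\<And>n. cs (n + N) = cs n" and l: "l \<noteq> 0"
    and v: "velocities r cs q N = l *\<^sub>R q" and g: "gaps r cs p q N = m *\<^sub>R p"
  shows "velocities r cs q (n + N) = l *\<^sub>R velocities r cs q n" "gaps r cs p q (n + N) = m *\<^sub>R gaps r cs p q n"
proof (induction n)
  case 0 case 1 show ?case using v by simp case 2 show ?case using g by simp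
next
  case (Suc n)
  case 1 show ?case using Suc per by (simp add: matrix_vector_mult_scaleR)
  case 2
  have "m * x / (l * y) * l = m * (x / y)" for x y using l by simp
  thus ?case using Suc per by (simp add: scaleR_right_diff_distrib)
qed

lemma scaled_history:
  assumes "collision_history r p q cs t P Q" "0 < a" "0 < b"
  shows "collision_history r (a *\<^sub>R p) (b *\<^sub>R q) cs (\<lambda>n. a / b * t n) (\<lambda>n. a *\<^sub>R P n) (\<lambda>n. b *\<^sub>R Q n)"
  unfolding collision_history_def
proof (intro conjI allI impI)
  note h = assms(1)[unfolded collision_history_def]
  note ab = assms(2,3)
  show "a / b * t 0 = 0" "a *\<^sub>R P 0 = a *\<^sub>R p" "b *\<^sub>R Q 0 = b *\<^sub>R q" "0 < a / b * t 1"
    using h ab by auto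
  fix n
  have t: "t n \<le> t (Suc n)" and P: "P (Suc n) = P n + (t (Suc n) - t n) *\<^sub>R Q n"
    and nn: "0 \<le> P (Suc n) $ i" and tr: "\<not> triple_collision (P (Suc n))"
    and c: "P (Suc n) $ gap_index (cs n) = 0" "Q n $ gap_index (cs n) < 0"
    and Q: "Q (Suc n) = collision_matrix r (cs n) *v Q n"
    and int: "t n < s \<Longrightarrow> s < t (Suc n) \<Longrightarrow> 0 < (P n + (s - t n) *\<^sub>R Q n) $ i" for i s
    using h by blast+
  show "a / b * t n \<le> a / b * t (Suc n)" using t ab by (intro mult_left_mono) auto
  have "(a / b * t (Suc n) - a / b * t n) * b = a * (t (Suc n) - t n)"
    using ab by (simp add: field_simps)
  thus "a *\<^sub>R P (Suc n) = a *\<^sub>R P n + (a / b * t (Suc n) - a / b * t n) *\<^sub>R b *\<^sub>R Q n"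
    unfolding P by (simp add: scaleR_right_distrib)
  show "0 \<le> (a *\<^sub>R P (Suc n)) $ i" for i using nn ab by simp
  show "\<not> triple_collision (a *\<^sub>R P (Suc n))" using tr ab by (auto simp: triple_collision_def)
  show "(a *\<^sub>R P (Suc n)) $ gap_index (cs n) = 0" using c by simp
  show "(b *\<^sub>R Q n) $ gap_index (cs n) < 0" using c ab by (simp add: mult_pos_neg)
  show "b *\<^sub>R Q (Suc n) = collision_matrix r (cs n) *v (b *\<^sub>R Q n)"
    unfolding Q by (simp add: matrix_vector_mult_scaleR)
  fix s i assume s: "a / b * t n < s \<and> s < a / b * t (Suc n)"
  have "t n < b / a * s" "b / a * s < t (Suc n)" using s ab by (simp_all add: field_simps)
  hence "0 < (P n + (b / a * s - t n) *\<^sub>R Q n) $ i" by (rule int)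
  hence "0 < (a *\<^sub>R (P n + (b / a * s - t n) *\<^sub>R Q n)) $ i" using ab by simp
  also have "a *\<^sub>R (P n + (b / a * s - t n) *\<^sub>R Q n) = a *\<^sub>R P n + (s - a / b * t n) *\<^sub>R b *\<^sub>R Q n"
  proof -
    have "a * (b / a * s - t n) = (s - a / b * t n) * b" using ab by (simp add: field_simps)
    thus ?thesis by (simp add: scaleR_right_distrib)
  qed
  finally show "0 < (a *\<^sub>R P n + (s - a / b * t n) *\<^sub>R b *\<^sub>R Q n) $ i" .
qed

section \<open>The explicit data are self-similar\<close>

lemma ababcb_periodic: "ababcb (n + 6) = ababcb n"
  by (simp add: ababcb_def)

lemma ababcb_values:
  "ababcb 0 = ColA" "ababcb 1 = ColB" "ababcb 2 = ColA" "ababcb 3 = ColB" "ababcb 4 = ColC"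
  "ababcb 5 = ColB"
  by (simp_all add: ababcb_def)

lemma less_6_cases:
  assumes "n < (6::nat)"
  obtains "n = 0" | "n = 1" | "n = 2" | "n = 3" | "n = 4" | "n = 5"
  using assms by linarith

lemma ababcb_alternates: "ababcb n \<noteq> ababcb (Suc n)"
proof -
  have "Suc n mod 6 = Suc (n mod 6) mod 6" by (simp add: mod_Suc_eq)
  note eq = this
  have "n mod 6 < 6" by simp
  thus ?thesis unfolding ababcb_def eq by (cases rule: less_6_cases) simp_all
qed

lemma ababcb_preceding: "ababcb (n + 5) \<noteq> ababcb n"
proof -
  have "Suc (n + 5) = n + 6" by simp
  thus ?thesis using ababcb_alternates[of "n + 5"] ababcb_periodic[of n] by metis
qed

lemma velocities_ababcb_6: "velocities r ababcb q 6 = mat_M r *v q"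
proof -
  have "6 = Suc (Suc (Suc (Suc (Suc (Suc 0)))))" by simp
  hence "velocities r ababcb q 6 = mat_B r *v (mat_C r *v (mat_B r *v (mat_A r *v (mat_B r *v (mat_A r *v q)))))"
    by (simp only: velocities.simps) (simp add: ababcb_def)
  thus ?thesis by (simp add: mat_M_def matrix_vector_mul_assoc matrix_mul_assoc)
qed

lemma inner_3: "(x :: real^3) \<bullet> y = x$1 * y$1 + x$2 * y$2 + x$3 * y$3"
  by (simp add: inner_vec_def sum_3)

lemma separating_simps:
  "separating ColA h \<longleftrightarrow> h$2 * h$3 < 0"
  "separating ColB h \<longleftrightarrow> h$1 * h$3 < 0"
  "separating ColC h \<longleftrightarrow> h$1 * h$2 < 0"
  unfolding separating_def forall_3 by (auto simp: mult.commute)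

lemma collision_matrix_simps:
  "(mat_A r *v x) $ 1 = - r * x$1" "(mat_A r *v x) $ 2 = (1 + r) / 2 * x$1 + x$2"
  "(mat_A r *v x) $ 3 = x$3"
  "(mat_B r *v x) $ 1 = x$1 + (1 + r) / 2 * x$2" "(mat_B r *v x) $ 2 = - r * x$2"
  "(mat_B r *v x) $ 3 = (1 + r) / 2 * x$2 + x$3"
  "(mat_C r *v x) $ 1 = x$1" "(mat_C r *v x) $ 2 = x$2 + (1 + r) / 2 * x$3"
  "(mat_C r *v x) $ 3 = - r * x$3"
  by (simp_all add: matrix_vector_mult_3 mat_A_def mat_B_def mat_C_def)

context separated_roots begin

text \<open>
  Like row_A and row_B, an entry of the transported left eigenvector, created by the last collision
  of the block.
\<close>

definition row_C :: real where "row_C = 2 * (m + r) / (1 + r)"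

text \<open>
  The normal vectors of the planes that contain gaps and velocities after n collisions. They are
  obtained backwards from the left eigenvector for m, so the first one is m times the last one.
\<close>

definition support_row :: "nat \<Rightarrow> real^3" where
  "support_row n = [vector [- m * gap_ratio r m, m * row_mid, m],
             vector [row_A, m * row_mid, m],
             vector [row_A, row_B, m],
             vector [- gap_ratio r m, row_B, m],
             vector [- gap_ratio r m, row_C, m],
             vector [- gap_ratio r m, row_C, 1],
             vector [- gap_ratio r m, row_mid, 1]] ! n"

lemma support_row_pullback:
  assumes "n < 6"
  shows "support_row (Suc n) \<bullet> (collision_matrix r (ababcb n) *v y) = support_row n \<bullet> y"
proof -
  define s x where "s = (1 + r) / 2" and "x = gap_ratio r m"
  note d = s_def[symmetric] x_def[symmetric]
  note R = row_relations[folded row_C_def, unfolded d]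
  have B: "row_B = s * (m - x) - r * row_C" unfolding row_B_def row_C_def d ..
  have A: "row_A = r * x + s * row_B" unfolding row_A_def d ..
  have C: "m = s * row_C - r" unfolding row_C_def s_def using r_pos by (simp add: field_simps)
  note simps = support_row_def inner_3 collision_matrix_simps d
  show ?thesis
    using assms
  proof (cases rule: less_6_cases)
    case 1
    have "support_row (Suc n) \<bullet> (collision_matrix r (ababcb n) *v y) - support_row n \<bullet> y
      = (- r * row_A + s * (m * row_mid) + m * x) * y$1"
      unfolding 1 by (simp add: simps ababcb_values algebra_simps)
    moreover have "- r * row_A + s * (m * row_mid) + m * x = 0" using R(3) by simp
    ultimately show ?thesis by simp
  next
    case 2
    have "support_row (Suc n) \<bullet> (collision_matrix r (ababcb n) *v y) - support_row n \<bullet> y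
      = (s * (row_A + m) - r * row_B - m * row_mid) * y$2"
      unfolding 2 by (simp add: simps ababcb_values[simplified] algebra_simps)
    thus ?thesis using R(2) by simp
  next
    case 3
    have "support_row (Suc n) \<bullet> (collision_matrix r (ababcb n) *v y) - support_row n \<bullet> y
      = (r * x + s * row_B - row_A) * y$1"
      unfolding 3 by (simp add: simps ababcb_values algebra_simps)
    thus ?thesis using A by simp
  next
    case 4
    have "support_row (Suc n) \<bullet> (collision_matrix r (ababcb n) *v y) - support_row n \<bullet> y
      = (s * (m - x) - r * row_C - row_B) * y$2"
      unfolding 4 by (simp add: simps ababcb_values algebra_simps)
    thus ?thesis using B by simp
  next
    case 5
    have "support_row (Suc n) \<bullet> (collision_matrix r (ababcb n) *v y) - support_row n \<bullet> y
      = (s * row_C - r - m) * y$3"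
      unfolding 5 by (simp add: simps ababcb_values algebra_simps)
    thus ?thesis using C by simp
  next
    case 6
    have "support_row (Suc n) \<bullet> (collision_matrix r (ababcb n) *v y) - support_row n \<bullet> y
      = (s * (1 - x) - r * row_mid - row_C) * y$2"
      unfolding 6 by (simp add: simps ababcb_values algebra_simps)
    thus ?thesis using R(1) by simp
  qed
qed

lemma support_row_separating:
  assumes "n < 6"
  shows "separating (ababcb n) (support_row (Suc n))"
proof -
  have "0 < row_C" using order r_pos by (simp add: row_C_def)
  with row_signs gap_ratio_m_pos order show ?thesis using \<open>n < 6\<close>
    by - (erule less_6_cases,
      auto simp: support_row_def ababcb_values[simplified] separating_simps mult_neg_pos mult_pos_neg)
qed

lemma explicit_q_eigen:
  assumes z: "z = S \<or> z = m \<or> z = L"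
  shows "mat_M r *v explicit_q r z = z *\<^sub>R explicit_q r z"
proof -
  have "charpoly_M r z = 0" using z roots by auto
  moreover have "- (r^3) + 6 * r^2 - r + 4 * z = 4 * (z - u_pole r)"
    by (simp add: u_pole_def field_simps power_numeral_reduce)
  hence "- (r^3) + 6 * r^2 - r + 4 * z \<noteq> 0" using z S m L by auto
  ultimately show ?thesis using r_pos by (intro explicit_q_eigenvector)
qed

text \<open>
  With s = (1 + r) / 2, the second velocity after three collisions is r s - (s^2 - r) (s - u), and
  the upper bound for u is exactly its negativity; this implies the conditions at the second and
  third collision. The conditions at the fifth and sixth collision are read off backwards: the block
  multiplies q by z, so u > 0 determines the sign of the last colliding velocity, and then that of
  the one before.
\<close>

lemma explicit_q_approaches:
  assumes z: "z = S \<or> z = L" and "n < 6"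
  shows "velocities r ababcb (explicit_q r z) n $ gap_index (ababcb n) < 0"
proof -
  define u s where "u = coeff_u r z" and "s = (1 + r) / 2"
  define q where "q = explicit_q r z"
  define V where "V = velocities r ababcb q"
  note w = coeff_u_window[OF z, folded u_def s_def]
  have q: "q $ 1 = -1" "q $ 2 = u" by (simp_all add: q_def explicit_q_def u_def)
  have zpos: "0 < z" using z S order by auto
  have eig: "mat_M r *v q = z *\<^sub>R q" unfolding q_def using z by (intro explicit_q_eigen) blast
  have V: "V 0 = q" "V 1 = mat_A r *v V 0" "V 2 = mat_B r *v V 1" "V 3 = mat_A r *v V 2"
    "V 4 = mat_B r *v V 3" "V 5 = mat_C r *v V 4" "V 6 = mat_B r *v V 5"
    using ababcb_values unfolding V_def by (simp_all add: numeral_eq_Suc)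
  have s2: "s^2 - r = (1 - r)^2 / 4" by (simp add: s_def field_simps power2_eq_square)
  have spos: "0 < s" "0 < (1 - r)^2" using r_pos r_less_1 by (simp_all add: s_def)
  have gap: "4 * r * s < (1 - r)^2 * (s - u)"
  proof -
    have "u * (1 - r)^2 < s * (r^2 - 6*r + 1)" using w(2) spos by (simp add: pos_less_divide_eq)
    also have "\<dots> = s * (1 - r)^2 - 4 * r * s" by (simp add: algebra_simps power2_eq_square)
    finally show ?thesis by (simp add: algebra_simps)
  qed
  have us: "u < s"
  proof -
    have "0 < (1 - r)^2 * (s - u)" using gap spos r_pos by (intro less_trans[OF _ gap]) simp
    thus ?thesis using spos by (simp add: zero_less_mult_iff)
  qed
  have V0: "V 0 $ 1 < 0" by (simp add: V q)
  have V12: "V 1 $ 1 = r" "V 1 $ 2 = u - s" unfolding V collision_matrix_simps q s_def by simp_all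
  have V2: "V 2 $ 1 = r - s * (s - u)" "V 2 $ 2 = r * (s - u)"
    unfolding V(3) collision_matrix_simps V12 s_def[symmetric] by (simp_all add: algebra_simps)
  have V3: "V 3 $ 2 = r * s - (s^2 - r) * (s - u)"
    unfolding V(4) collision_matrix_simps V2 s_def[symmetric]
    by (simp add: algebra_simps power2_eq_square)
  have V3': "V 3 $ 2 < 0" unfolding V3 s2 using gap by simp
  have V2': "V 2 $ 1 < 0"
  proof -
    have "s * (r - s * (s - u)) + r * (s - u) = V 3 $ 2"
      unfolding V3 by (simp add: algebra_simps power2_eq_square)
    moreover have "0 < r * (s - u)" using us r_pos by simp
    ultimately have "s * V 2 $ 1 < 0" using V3' unfolding V2 by linarith
    thus ?thesis using spos by (simp add: mult_less_0_iff)
  qed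
  have "V 6 = z *\<^sub>R q" using eig velocities_ababcb_6 unfolding V_def by simp
  hence "- r * V 5 $ 2 = z * u" unfolding V(7) using collision_matrix_simps(5)[of r "V 5"] q by (metis vector_scaleR_component real_scaleR_def)
  hence "r * V 5 $ 2 < 0" using zpos w(1) by (smt (verit) mult_pos_pos mult_minus_left)
  hence V5: "V 5 $ 2 < 0" using r_pos by (simp add: mult_less_0_iff)
  have V4: "V 4 $ 3 < 0"
  proof -
    have "V 5 $ 2 = - r * V 3 $ 2 + s * V 4 $ 3" unfolding V(6) collision_matrix_simps
      unfolding V(5) collision_matrix_simps s_def by simp
    moreover have "0 < - r * V 3 $ 2" using V3' r_pos by (simp add: mult_pos_neg)
    ultimately have "s * V 4 $ 3 < 0" using V5 by linarith
    thus ?thesis using spos by (simp add: mult_less_0_iff)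
  qed
  have "V n $ gap_index (ababcb n) < 0" using \<open>n < 6\<close>
    by (cases rule: less_6_cases) (use V0 V12 us V2' V3' V4 V5 ababcb_values in simp_all)
  thus ?thesis unfolding V_def q_def .
qed

text \<open>
  The velocity is orthogonal to the first support row since q and the left eigenvector belong to
  different eigenvalues. So flight_keeps_gaps_positive applies six times, and the final gap vector is
  again in the line cut out by p$2 = 0 and the left eigenvector. From there on the orbit repeats up
  to scaling.
\<close>

lemma explicit_history:
  assumes z: "z = S \<or> z = L"
  defines "p \<equiv> explicit_p r z" and "q \<equiv> explicit_q r z"
  shows "collision_history r p q ababcb (collision_time r ababcb p q) (gaps r ababcb p q) (velocities r ababcb q)"
    and "\<exists>k. gaps r ababcb p q 6 = k *\<^sub>R p" and "velocities r ababcb q 6 = z *\<^sub>R q"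
    and "initial_datum p q"
proof -
  define P where "P = gaps r ababcb p q"
  define V where "V = velocities r ababcb q"
  have V_Suc: "V (Suc n) = collision_matrix r (ababcb n) *v V n" for n by (simp add: V_def)
  have p: "p $ 1 = 1" "p $ 2 = 0" "p $ 3 = gap_ratio r m"
    using coeff_x_eq[OF z] by (simp_all add: p_def explicit_p_def)
  have u: "0 < q $ 2" using coeff_u_window(1)[OF z] by (simp add: q_def explicit_q_def)
  have zpos: "0 < z" using z S order by auto
  have V6: "V 6 = z *\<^sub>R q" unfolding V_def velocities_ababcb_6 q_def using z by (intro explicit_q_eigen) auto
  thus "velocities r ababcb q 6 = z *\<^sub>R q" unfolding V_def .
  have neg: "V n $ gap_index (ababcb n) < 0" if "n < 6" for n
    using explicit_q_approaches[OF z that] unfolding V_def q_def .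
  have tp: "touching ColB p" using p gap_ratio_m_pos by (simp add: touching_simps)
  show "initial_datum p q" unfolding initial_datum_def
    using touching_nonneg[OF tp] touching_not_triple[OF tp] u p by simp
  \<comment> \<open>The velocity lies in the planes: left and right eigenvectors for different eigenvalues
    are orthogonal.\<close>
  have chain: "n \<le> 6 \<Longrightarrow> support_row n \<bullet> V n = support_row 0 \<bullet> q" for n
  proof (induction n)
    case (Suc n)
    thus ?case unfolding V_Suc using support_row_pullback[of n] by simp
  qed (simp add: V_def)
  have r06: "support_row 0 = m *\<^sub>R support_row 6" by (simp add: support_row_def vec3_eq_iff)
  have "support_row 6 \<bullet> V 6 = support_row 0 \<bullet> q" using chain[of 6] by simp
  hence "z * (support_row 6 \<bullet> q) = m * (support_row 6 \<bullet> q)" unfolding V6 r06 by simp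
  moreover have "z \<noteq> m" using z order by auto
  ultimately have "support_row 6 \<bullet> q = 0" by simp
  hence rq: "support_row 0 \<bullet> q = 0" unfolding r06 by simp
  have inv: "n \<le> 6 \<Longrightarrow> touching (ababcb (n + 5)) (P n) \<and> support_row n \<bullet> P n = 0 \<and> support_row n \<bullet> V n = 0" for n
  proof (induction n)
    case 0
    have "support_row 0 \<bullet> p = 0" unfolding inner_3 p by (simp add: support_row_def)
    thus ?case using tp rq by (simp add: P_def V_def ababcb_values)
  next
    case (Suc n)
    hence n: "n < 6" and IH: "touching (ababcb (n + 5)) (P n)" "support_row n \<bullet> P n = 0" "support_row n \<bullet> V n = 0"
      by auto
    have pos: "0 < V n $ gap_index (ababcb (n + 5))"
    proof (cases n)
      case 0 thus ?thesis using u by (simp add: V_def ababcb_values)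
    next
      case (Suc k)
      have "V n $ gap_index (ababcb k) = - r * V k $ gap_index (ababcb k)"
        unfolding Suc V_Suc by (rule collision_reverses)
      moreover have "V k $ gap_index (ababcb k) < 0" using n Suc by (intro neg) simp
      moreover have "ababcb (n + 5) = ababcb k" using ababcb_periodic[of k] Suc by (simp add: add.commute)
      ultimately show ?thesis using r_pos by (simp add: mult_pos_neg)
    qed
    have "P (Suc n) = P n - (P n $ gap_index (ababcb n) / V n $ gap_index (ababcb n)) *\<^sub>R V n"
      by (simp add: P_def V_def)
    with flight_keeps_gaps_positive[OF ababcb_preceding[symmetric] IH(1) neg[OF n] pos IH(2,3)
        support_row_pullback[OF n] support_row_separating[OF n]]
    have "touching (ababcb n) (P (Suc n))" "support_row (Suc n) \<bullet> P (Suc n) = 0" "support_row (Suc n) \<bullet> V (Suc n) = 0"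
      unfolding V_Suc by simp_all
    thus ?case using ababcb_periodic[of n] by (simp add: add.commute)
  qed
  have touch6: "touching (ababcb n) (P (Suc n))" if "n < 6" for n
    using inv[of "Suc n"] that ababcb_periodic[of n] by (simp add: add.commute)
  define k where "k = P 6 $ 1"
  have t6: "touching ColB (P 6)" using touch6[of 5] by (simp add: ababcb_values)
  have "support_row 6 \<bullet> P 6 = 0" using inv[of 6] by simp
  hence P6: "P 6 = k *\<^sub>R p" and kpos: "0 < k"
    using t6 unfolding k_def touching_simps inner_3 vec3_eq_iff by (simp_all add: support_row_def p)
  thus "\<exists>k. gaps r ababcb p q 6 = k *\<^sub>R p" unfolding P_def by blast
  note per = orbit_periodic_scaling[of ababcb 6, OF ababcb_periodic _ V6[unfolded V_def] P6[unfolded P_def],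
      folded V_def P_def]
  have neg': "V n $ gap_index (ababcb n) < 0" and touch': "touching (ababcb n) (P (Suc n))" for n
  proof (induction n rule: less_induct)
    case (less n)
    show "V n $ gap_index (ababcb n) < 0" "touching (ababcb n) (P (Suc n))"
    proof (atomize(full), cases "n < 6")
      case True
      thus "V n $ gap_index (ababcb n) < 0 \<and> touching (ababcb n) (P (Suc n))" using neg touch6 by blast
    next
      case False
      then obtain j where j: "n = j + 6" by (metis add.commute le_Suc_ex not_less)
      have "Suc (j + 6) = Suc j + 6" by simp
      hence "V n = z *\<^sub>R V j" "P (Suc n) = k *\<^sub>R P (Suc j)" "ababcb n = ababcb j"
        using per[of j] per[of "Suc j"] zpos ababcb_periodic[of j] unfolding j by auto
      moreover have "j < n" using j by simp
      ultimately show "V n $ gap_index (ababcb n) < 0 \<and> touching (ababcb n) (P (Suc n))"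
        using less[of j] zpos kpos by (auto simp: touching_def mult_pos_neg)
    qed
  qed
  show "collision_history r p q ababcb (collision_time r ababcb p q) (gaps r ababcb p q) (velocities r ababcb q)"
    using tp touch' neg' ababcb_alternates unfolding P_def V_def
    by (intro history_of_orbit[of ColB]) (auto simp: ababcb_values)
qed

lemma explicit_self_similar:
  assumes "z = S \<or> z = L" "0 < \<alpha>" "0 < \<beta>"
  shows "self_similar_datum r (\<alpha> *\<^sub>R explicit_p r z) (\<beta> *\<^sub>R explicit_q r z)"
proof -
  note h = explicit_history[OF assms(1)]
  have "initial_datum (\<alpha> *\<^sub>R explicit_p r z) (\<beta> *\<^sub>R explicit_q r z)"
    using h(4) assms(2,3) by (auto simp: initial_datum_def triple_collision_def)
  moreover obtain k where "gaps r ababcb (explicit_p r z) (explicit_q r z) 6 = k *\<^sub>R explicit_p r z"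
    using h(2) by blast
  hence "\<exists>k. \<alpha> *\<^sub>R gaps r ababcb (explicit_p r z) (explicit_q r z) 6 = k *\<^sub>R \<alpha> *\<^sub>R explicit_p r z"
    by (intro exI[of _ k]) simp
  moreover have "\<exists>k. \<beta> *\<^sub>R velocities r ababcb (explicit_q r z) 6 = k *\<^sub>R \<beta> *\<^sub>R explicit_q r z"
    using h(3) by (intro exI[of _ z]) simp
  ultimately show ?thesis unfolding self_similar_datum_def
    using scaled_history[OF h(1) assms(2,3)] by blast
qed

end

section \<open>Self-similar data are explicit\<close>

lemma history_velocities:
  assumes "collision_history r p q cs t P Q"
  shows "Q n = velocities r cs q n"
proof -
  have "Q 0 = q" "Q (Suc n) = collision_matrix r (cs n) *v Q n" for n
    using assms unfolding collision_history_def by blast+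
  thus ?thesis by (induction n) simp_all
qed

text \<open>
  The virtual gaps P n - t n Q n follow the same linear recursion as the velocities, because a gap
  vector with vanishing colliding component is fixed by the collision matrix.
\<close>

lemma history_gaps:
  assumes h: "collision_history r p q cs t P Q"
  shows "P n = velocities r cs p n + t n *\<^sub>R velocities r cs q n"
proof (induction n)
  case 0 thus ?case using h by (simp add: collision_history_def)
next
  case (Suc n)
  have P: "P (Suc n) = P n + (t (Suc n) - t n) *\<^sub>R Q n" and z: "P (Suc n) $ gap_index (cs n) = 0"
    using h unfolding collision_history_def by blast+
  have E: "P (Suc n) = velocities r cs p n + t (Suc n) *\<^sub>R velocities r cs q n"
    unfolding P Suc history_velocities[OF h] by (simp add: algebra_simps)
  have "P (Suc n) = collision_matrix r (cs n) *v P (Suc n)" using collision_matrix_fixes[OF z] by simp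
  also have "\<dots> = velocities r cs p (Suc n) + t (Suc n) *\<^sub>R velocities r cs q (Suc n)"
    unfolding E by (simp add: matrix_vector_right_distrib matrix_vector_mult_scaleR)
  finally show ?case .
qed

lemma velocities_add: "velocities r cs q (n + k) = velocities r (\<lambda>i. cs (n + i)) (velocities r cs q n) k"
  by (induction k) simp_all

lemma velocities_ababcb_Suc: "velocities r ababcb q (6 * Suc k) = mat_M r *v velocities r ababcb q (6 * k)"
proof -
  have "(\<lambda>i. ababcb (6 * k + i)) = ababcb" by (auto simp: ababcb_def)
  hence "velocities r ababcb q (6 * k + 6) = velocities r ababcb (velocities r ababcb q (6 * k)) 6"
    by (simp add: velocities_add)
  thus ?thesis by (simp add: velocities_ababcb_6 add.commute)
qed

lemma ababcb_mult_6: "ababcb (6 * k) = ColA" "ababcb (6 * k + 5) = ColB"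
  by (simp_all add: ababcb_def)

text \<open>
  The scalars l and n are positive since the first velocity is again negative, and the first gap
  again positive, at the start of the second block.
\<close>

lemma self_similar_invariant_plane:
  assumes "self_similar_datum r p q"
  obtains l n T where "0 < l" "0 < n" "mat_M r *v q = l *\<^sub>R q" "mat_M r *v p = n *\<^sub>R p - T *\<^sub>R q"
    "p $ 2 = 0" "0 < p $ 1" "0 < p $ 3" "0 < q $ 2" "q $ 1 < 0"
proof -
  from assms obtain t P Q l n where h: "collision_history r p q ababcb t P Q"
    and l: "Q 6 = l *\<^sub>R q" and n: "P 6 = n *\<^sub>R p" and i: "initial_datum p q"
    unfolding self_similar_datum_def by blast
  have pos: "p $ 2 = 0" "0 < p $ 1" "0 < p $ 3" "0 < q $ 2"
    using i unfolding initial_datum_def triple_collision_def by (auto simp: less_le)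
  have step: "P (Suc n) $ gap_index (ababcb n) = 0" "Q n $ gap_index (ababcb n) < 0"
    "\<not> triple_collision (P (Suc n))" "0 \<le> P (Suc n) $ i" for n i
    using h unfolding collision_history_def by blast+
  have Q0: "Q 0 = q" using h unfolding collision_history_def by blast
  have q1: "q $ 1 < 0" using step(2)[of 0] Q0 by (simp add: ababcb_values)
  have "Q 6 $ 1 < 0" using step(2)[of 6] ababcb_mult_6(1)[of 1] by simp
  hence "0 < l" using l q1 by (simp add: mult_less_0_iff)
  moreover have "P 6 $ 2 = 0" "\<not> triple_collision (P 6)" "0 \<le> P 6 $ 1"
    using step(1,3,4)[of 5] ababcb_values by simp_all
  hence "0 < P 6 $ 1" by (auto simp: triple_collision_def less_le)
  hence "0 < n" using n pos by (simp add: zero_less_mult_iff)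
  moreover have M: "mat_M r *v q = l *\<^sub>R q" using l history_velocities[OF h, of 6] velocities_ababcb_6 by simp
  moreover have "mat_M r *v p = n *\<^sub>R p - (t 6 * l) *\<^sub>R q"
    using n history_gaps[OF h, of 6] M unfolding velocities_ababcb_6 by (simp add: algebra_simps)
  ultimately show thesis using that pos q1 by blast
qed

text \<open>
  Normalizing to p = (1, 0, x) and q = (-1, u, v) makes third_eigenvalue applicable. Here k > 0
  because l n k = r^6.
\<close>

lemma self_similar_roots:
  assumes r: "0 < r" "r < 1" and ss: "self_similar_datum r p q"
  obtains l n k T where "0 < l" "0 < n" "0 < k"
    "mat_M r *v q = l *\<^sub>R q" "mat_M r *v p = n *\<^sub>R p - T *\<^sub>R q"
    "trace_M r = l + n + k" "minors_M r = l*n + n*k + k*l" "r^6 = l*n*k"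
    "p $ 2 = 0" "0 < p $ 1" "0 < p $ 3" "0 < q $ 2" "q $ 1 < 0"
    "p $ 3 / p $ 1 * (1 - r)^2 * (k - r^2) = k * (1 - r^2) * (1 - r)^2 - 4 * (k^2 - r^4)"
proof -
  obtain l n T where l: "0 < l" "0 < n" and M: "mat_M r *v q = l *\<^sub>R q" "mat_M r *v p = n *\<^sub>R p - T *\<^sub>R q"
    and pos: "p $ 2 = 0" "0 < p $ 1" "0 < p $ 3" "0 < q $ 2" "q $ 1 < 0"
    by (rule self_similar_invariant_plane[OF ss])
  define \<beta> where "\<beta> = - q $ 1"
  define \<alpha> where "\<alpha> = p $ 1"
  define u v x where "u = q $ 2 / \<beta>" and "v = q $ 3 / \<beta>" and "x = p $ 3 / p $ 1"
  have ab: "0 < \<alpha>" "0 < \<beta>" using pos by (simp_all add: \<alpha>_def \<beta>_def)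
  have q: "vector [-1, u, v] = (1 / \<beta>) *\<^sub>R q" using ab by (simp add: vec3_eq_iff u_def v_def \<beta>_def)
  have p: "vector [1, 0, x] = (1 / \<alpha>) *\<^sub>R p" using ab pos by (simp add: vec3_eq_iff x_def \<alpha>_def)
  have e1: "mat_M r *v vector [-1, u, v] = l *\<^sub>R vector [-1, u, v]"
    unfolding q by (simp add: matrix_vector_mult_scaleR M)
  have e2: "mat_M r *v vector [1, 0, x] = n *\<^sub>R vector [1, 0, x] + (- T * \<beta> / \<alpha>) *\<^sub>R vector [-1, u, v]"
    unfolding q p using ab by (simp add: matrix_vector_mult_scaleR M algebra_simps)
  have u: "u \<noteq> 0" using ab pos by (simp add: u_def)
  obtain k y where col:
    "- x * mat_M r $1$1 + y * mat_M r $2$1 + mat_M r $3$1 = - k * x"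
    "- x * mat_M r $1$2 + y * mat_M r $2$2 + mat_M r $3$2 = k * y"
    "- x * mat_M r $1$3 + y * mat_M r $2$3 + mat_M r $3$3 = k"
    and tr: "mat_M r $1$1 + mat_M r $2$2 + mat_M r $3$3 = l + n + k"
    using third_eigenvalue[OF e1 e2 u] by metis
  have t: "trace_M r = l + n + k" using tr mat_M_trace_minors by simp
  have m: "minors_M r = l*n + n*k + k*l"
    using third_eigenvalue_minors[OF e1 e2 u tr] mat_M_trace_minors by simp
  have "real_eigenvalue (mat_M r) l" unfolding real_eigenvalue_def
    using M(1) pos by (intro exI[of _ q]) auto
  hence "charpoly_M r l = 0" by (rule eigenvalue_imp_root)
  hence d: "r^6 = l*n*k" unfolding charpoly_M_def t m by (simp add: algebra_simps power2_eq_square power3_eq_cube)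
  have "0 < l * n * k" using d r by (metis zero_less_power)
  hence "0 < k" by (rule zero_less_mult_pos) (use l in simp)
  with l M t m d pos left_eigenvector_gap[OF r(1) col] show thesis
    unfolding x_def by (intro that)
qed

lemma self_similar_imp_threshold:
  assumes "0 < r" "r < 1" "self_similar_datum r p q"
  shows "0 < threshold r"
proof (rule ccontr)
  assume "\<not> ?thesis"
  moreover obtain l n k T where "0 < l" "0 < n" "0 < k"
    "mat_M r *v p = n *\<^sub>R p - T *\<^sub>R q"
    "trace_M r = l + n + k" "minors_M r = l*n + n*k + k*l" "r^6 = l*n*k" "0 < p $ 1" "0 < p $ 3"
    "p $ 3 / p $ 1 * (1 - r)^2 * (k - r^2) = k * (1 - r^2) * (1 - r)^2 - 4 * (k^2 - r^4)"
    by (rule self_similar_roots[OF assms])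
  ultimately show False using no_admissible_roots[of r l n k "p $ 3 / p $ 1"] assms by simp
qed

context separated_roots begin

lemma largest_iff: "largest_real_eigenvalue (mat_M r) z \<longleftrightarrow> z = L"
  and smallest_iff: "smallest_real_eigenvalue (mat_M r) z \<longleftrightarrow> z = S"
proof -
  have "explicit_q r z \<noteq> 0" for z by (simp add: vec3_eq_iff explicit_q_def)
  hence "real_eigenvalue (mat_M r) z \<longleftrightarrow> z = S \<or> z = m \<or> z = L" for z
    using eigenvalue_imp_root root_cases explicit_q_eigen unfolding real_eigenvalue_def by metis
  thus "largest_real_eigenvalue (mat_M r) z \<longleftrightarrow> z = L"
    "smallest_real_eigenvalue (mat_M r) z \<longleftrightarrow> z = S"
    unfolding largest_real_eigenvalue_def smallest_real_eigenvalue_def using order by auto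
qed

text \<open>
  A difference of two normalized eigenvectors has first component 0. The combination of the first two
  rows that eliminates the third component leaves (u_pole - z) times the second component.
\<close>

lemma eigenvector_unique:
  assumes q: "mat_M r *v q = z *\<^sub>R q" and z: "z = S \<or> z = m \<or> z = L"
  shows "q = (- q $ 1) *\<^sub>R explicit_q r z"
proof -
  define w where "w = q + q $ 1 *\<^sub>R explicit_q r z"
  have w1: "w $ 1 = 0" by (simp add: w_def explicit_q_def)
  have "mat_M r *v w = z *\<^sub>R w" unfolding w_def
    by (simp add: matrix_vector_right_distrib matrix_vector_mult_scaleR q explicit_q_eigen[OF z] algebra_simps)
  hence e: "mat_M r $1$2 * w$2 + mat_M r $1$3 * w$3 = 0"
      "mat_M r $2$2 * w$2 + mat_M r $2$3 * w$3 = z * w$2"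
    using w1 by (simp_all add: vec3_eq_iff matrix_vector_mult_3)
  have "2 * r * mat_M r $1$2 + (1 + r) * mat_M r $2$2 = (1 + r) * u_pole r"
    "2 * r * mat_M r $1$3 + (1 + r) * mat_M r $2$3 = 0"
    unfolding mat_M_entries u_pole_def by (simp_all add: field_simps power_numeral_reduce)
  hence "(1 + r) * (u_pole r - z) * w$2 = 0" using e by algebra
  hence w2: "w$2 = 0" using z S m L r_pos by auto
  hence "w$3 = 0" using e(1) r_pos by (simp add: mat_M_entries)
  hence "w = 0" using w1 w2 by (simp add: vec3_eq_iff)
  thus ?thesis unfolding w_def by (simp add: add_eq_0_iff)
qed

lemma self_similar_form:
  assumes "self_similar_datum r p q"
  obtains l n T \<alpha> \<beta> where "l = S \<and> n = L \<or> l = L \<and> n = S" "0 < \<alpha>" "0 < \<beta>"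
    "p = \<alpha> *\<^sub>R explicit_p r l" "q = \<beta> *\<^sub>R explicit_q r l"
    "mat_M r *v p = n *\<^sub>R p - T *\<^sub>R q"
proof -
  obtain l n k T where l: "0 < l" "0 < n" "0 < k"
    and M: "mat_M r *v q = l *\<^sub>R q" "mat_M r *v p = n *\<^sub>R p - T *\<^sub>R q"
    and v: "trace_M r = l + n + k" "minors_M r = l*n + n*k + k*l" "r^6 = l*n*k"
    and pos: "p $ 2 = 0" "0 < p $ 1" "0 < p $ 3" "0 < q $ 2" "q $ 1 < 0"
    and e: "p $ 3 / p $ 1 * (1 - r)^2 * (k - r^2) = k * (1 - r^2) * (1 - r)^2 - 4 * (k^2 - r^4)"
    by (rule self_similar_roots[OF r_pos r_less_1 assms])
  have x: "0 < p $ 3 / p $ 1" using pos by simp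
  note adm = admissible_roots[OF l x v e]
  have ln: "l = S \<and> n = L \<or> l = L \<and> n = S"
    using adm(1,3) v(1) root_relations(1) by auto
  hence "coeff_x r l = p $ 3 / p $ 1" using coeff_x_eq[of l] adm(2) by auto
  hence "p = p $ 1 *\<^sub>R explicit_p r l" using pos by (simp add: vec3_eq_iff explicit_p_def)
  moreover have "q = (- q $ 1) *\<^sub>R explicit_q r l" using eigenvector_unique[OF M(1)] ln by blast
  ultimately show thesis using that[of l n "p $ 1" "- q $ 1" T] ln pos M(2) by simp
qed

section \<open>Instability\<close>

lemma power_overtakes:
  fixes a b c e :: real
  assumes "0 < a" "a < b" "0 < e"
  shows "\<exists>n. c * a ^ n < e * b ^ n"
proof -
  have "1 < b / a" using assms by simp
  then obtain n where "c / e < (b / a) ^ n" using real_arch_pow by blast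
  hence "c * a ^ n < e * b ^ n" using assms by (simp add: power_divide field_simps)
  thus ?thesis ..
qed

lemma small_perturbation:
  fixes a b :: "'a :: real_normed_vector"
  assumes "open U" "a \<in> U"
  obtains e where "0 < e" "\<And>s. 0 \<le> s \<Longrightarrow> s \<le> e \<Longrightarrow> a + s *\<^sub>R b \<in> U"
proof -
  obtain d where d: "0 < d" "ball a d \<subseteq> U" using assms open_contains_ball by blast
  define K where "K = norm b + 1"
  define e where "e = d / 2 / K"
  have K: "0 < K" "norm b \<le> K" using norm_ge_zero[of b] unfolding K_def by linarith+
  have "a + s *\<^sub>R b \<in> U" if s: "0 \<le> s" "s \<le> e" for s
  proof -
    have "s * norm b \<le> e * K" using s K by (intro mult_mono) auto
    also have "\<dots> = d / 2" using K by (simp add: e_def)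
    finally have "norm (s *\<^sub>R b) < d" using d s by simp
    thus ?thesis using d by (auto simp: dist_norm)
  qed
  moreover have "0 < e" using d K by (simp add: e_def)
  ultimately show thesis using that by blast
qed

text \<open>
  Only perturbations of p with vanishing second component stay among the initial data.
\<close>

lemma small_perturbation_datum:
  assumes i: "initial_datum p q" and "open U" "(p, q) \<in> U" and b: "b $ 2 = 0"
  obtains e where "0 < e" "(p + e *\<^sub>R b, q + e *\<^sub>R c) \<in> U" "initial_datum (p + e *\<^sub>R b) (q + e *\<^sub>R c)"
proof -
  have pos: "p $ 2 = 0" "0 < p $ 1" "0 < p $ 3" "0 < q $ 2"
    using i unfolding initial_datum_def triple_collision_def by (auto simp: less_le)
  define V where "V = {z :: (real^3) \<times> (real^3). 0 < fst z $ 1} \<inter> {z. 0 < fst z $ 3} \<inter> {z. 0 < snd z $ 2}"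
  have "open V" unfolding V_def
    by (intro open_Int open_Collect_less continuous_intros)
  hence "open (U \<inter> V)" "(p, q) \<in> U \<inter> V" using assms pos by (auto simp: V_def)
  then obtain e where e: "0 < e" "(p, q) + e *\<^sub>R (b, c) \<in> U \<inter> V"
    using small_perturbation[of "U \<inter> V" "(p, q)" "(b, c)"] by (metis order_refl less_imp_le)
  hence "(p + e *\<^sub>R b, q + e *\<^sub>R c) \<in> U" and V: "(p + e *\<^sub>R b, q + e *\<^sub>R c) \<in> V" by simp_all
  moreover have "initial_datum (p + e *\<^sub>R b) (q + e *\<^sub>R c)"
    using V pos b unfolding V_def initial_datum_def triple_collision_def forall_3 by auto
  ultimately show thesis using that e by blast
qed

lemma generates_velocity_sign:
  assumes "generates r p q ababcb"
  shows "velocities r ababcb q (6 * k) $ 1 < 0"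
proof -
  obtain t P Q where h: "collision_history r p q ababcb t P Q"
    using assms unfolding generates_def by blast
  hence "Q (6 * k) $ gap_index (ababcb (6 * k)) < 0" unfolding collision_history_def by blast
  thus ?thesis using history_velocities[OF h] by (simp add: ababcb_mult_6)
qed

lemma generates_gap_signs:
  assumes "generates r p q ababcb" "initial_datum p q"
  obtains t where "0 \<le> (velocities r ababcb p (6 * k) + t *\<^sub>R velocities r ababcb q (6 * k)) $ 1"
    "(velocities r ababcb p (6 * k) + t *\<^sub>R velocities r ababcb q (6 * k)) $ 2 = 0"
proof -
  obtain t P Q where h: "collision_history r p q ababcb t P Q"
    using assms unfolding generates_def by blast
  have "0 \<le> P (6 * k) $ 1 \<and> P (6 * k) $ 2 = 0"
  proof (cases k)
    case 0
    have "P 0 = p" using h unfolding collision_history_def by blast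
    thus ?thesis using assms(2) 0 by (simp add: initial_datum_def)
  next
    case (Suc j)
    have "6 * k = Suc (6 * j + 5)" using Suc by simp
    moreover have "P (Suc (6 * j + 5)) $ gap_index (ababcb (6 * j + 5)) = 0"
      "0 \<le> P (Suc (6 * j + 5)) $ 1"
      using h unfolding collision_history_def by blast+
    ultimately show ?thesis by (simp add: ababcb_mult_6(2)[simplified])
  qed
  thus thesis using that[of "t (6 * k)"] history_gaps[OF h, of "6 * k"] by simp
qed

text \<open>
  Subtracting a small multiple of the eigenvector for L makes the first velocity after k blocks equal
  to a negative multiple of S^k plus a positive multiple of L^k, which becomes positive.
\<close>

lemma not_stable_smallest:
  assumes i: "initial_datum p q" and q: "q = \<beta> *\<^sub>R explicit_q r S"
  shows "\<not> stable_datum r p q"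
proof
  assume "stable_datum r p q"
  then obtain U where U: "open U" "(p, q) \<in> U"
    "\<And>p' q'. (p', q') \<in> U \<Longrightarrow> initial_datum p' q' \<Longrightarrow> generates r p' q' ababcb"
    unfolding stable_datum_def by blast
  obtain e where e: "0 < e" "(p + e *\<^sub>R 0, q + e *\<^sub>R (- explicit_q r L)) \<in> U"
    "initial_datum (p + e *\<^sub>R 0) (q + e *\<^sub>R (- explicit_q r L))"
    by (rule small_perturbation_datum[OF i U(1,2), of 0 "- explicit_q r L"]) simp
  define q' where "q' = q + e *\<^sub>R (- explicit_q r L)"
  have gen: "generates r p q' ababcb" using U(3)[OF e(2,3)] by (simp add: q'_def)
  have "velocities r ababcb q' (6 * k) = (\<beta> * S ^ k) *\<^sub>R explicit_q r S - (e * L ^ k) *\<^sub>R explicit_q r L" for k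
  proof (induction k)
    case 0 show ?case by (simp add: q'_def q)
  next
    case (Suc k)
    show ?case unfolding velocities_ababcb_Suc Suc
      by (simp add: matrix_vector_mult_diff_distrib matrix_vector_mult_scaleR explicit_q_eigen mult_ac)
  qed
  hence "- (\<beta> * S ^ k) + e * L ^ k < 0" for k
    using generates_velocity_sign[OF gen, of k] by (simp add: explicit_q_def)
  moreover obtain k where "\<beta> * S ^ k < e * L ^ k" using power_overtakes[of S L e \<beta>] S e order by auto
  ultimately show False by (smt (verit))
qed

text \<open>
  Keep q and move p by a multiple of y, the combination of the eigenvectors for m and L with
  vanishing second component. After k blocks the gaps are S^k p + e m^k y up to a multiple of the
  eigenvector w for L. That multiple vanishes because the second gap is 0 and w$2 is not. Since
  y$1 < 0 and m > S, the first gap becomes negative.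
\<close>

lemma not_stable_largest:
  assumes i: "initial_datum p q" and q: "q = \<beta> *\<^sub>R explicit_q r L"
    and p: "mat_M r *v p = S *\<^sub>R p - T *\<^sub>R q"
  shows "\<not> stable_datum r p q"
proof
  assume "stable_datum r p q"
  then obtain U where U: "open U" "(p, q) \<in> U"
    "\<And>p' q'. (p', q') \<in> U \<Longrightarrow> initial_datum p' q' \<Longrightarrow> generates r p' q' ababcb"
    unfolding stable_datum_def by blast
  define w where "w = explicit_q r L"
  define y where "y = w $ 2 *\<^sub>R explicit_q r m - explicit_q r m $ 2 *\<^sub>R w"
  have Mw: "mat_M r *v w = L *\<^sub>R w" unfolding w_def by (intro explicit_q_eigen) simp
  have My: "mat_M r *v y = m *\<^sub>R y + ((m - L) * explicit_q r m $ 2) *\<^sub>R w"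
    unfolding y_def by (simp add: matrix_vector_mult_diff_distrib matrix_vector_mult_scaleR Mw
       explicit_q_eigen algebra_simps)
  have w2: "0 < w $ 2" using coeff_u_window(1)[of L] by (simp add: w_def explicit_q_def)
  have y2: "y $ 2 = 0" by (simp add: y_def)
  have y1: "y $ 1 < 0" using coeff_u_m w2 by (simp add: y_def w_def explicit_q_def)
  have p2: "p $ 2 = 0" using i by (simp add: initial_datum_def)
  obtain e where e: "0 < e" "(p + e *\<^sub>R y, q + e *\<^sub>R 0) \<in> U" "initial_datum (p + e *\<^sub>R y) (q + e *\<^sub>R 0)"
    by (rule small_perturbation_datum[OF i U(1,2) y2, of 0])
  define p' where "p' = p + e *\<^sub>R y"
  have i': "initial_datum p' q" and gen: "generates r p' q ababcb"
    using U(3)[OF e(2,3)] e(3) by (simp_all add: p'_def)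
  have vp: "\<exists>c. velocities r ababcb p' (6 * k) = S ^ k *\<^sub>R p + (e * m ^ k) *\<^sub>R y + c *\<^sub>R w" for k
  proof (induction k)
    case 0 show ?case by (intro exI[of _ 0]) (simp add: p'_def)
  next
    case (Suc k)
    then obtain c where "velocities r ababcb p' (6 * k) = S ^ k *\<^sub>R p + (e * m ^ k) *\<^sub>R y + c *\<^sub>R w" by blast
    hence "velocities r ababcb p' (6 * Suc k) = S ^ Suc k *\<^sub>R p + (e * m ^ Suc k) *\<^sub>R y
       + (c * L - S ^ k * T * \<beta> + e * m ^ k * ((m - L) * explicit_q r m $ 2)) *\<^sub>R w"
      unfolding velocities_ababcb_Suc
      by (simp add: matrix_vector_right_distrib matrix_vector_mult_scaleR Mw My p q w_def[symmetric]
          algebra_simps)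
    thus ?case by blast
  qed
  have vq: "\<exists>c. velocities r ababcb q (6 * k) = c *\<^sub>R w" for k
  proof (induction k)
    case 0 show ?case by (intro exI[of _ \<beta>]) (simp add: q w_def)
  next
    case (Suc k)
    then obtain c where "velocities r ababcb q (6 * k) = c *\<^sub>R w" by blast
    thus ?case unfolding velocities_ababcb_Suc
      by (intro exI[of _ "c * L"]) (simp add: matrix_vector_mult_scaleR Mw)
  qed
  have nonneg: "0 \<le> S ^ k * p $ 1 + e * m ^ k * y $ 1" for k
  proof -
    obtain c where c: "velocities r ababcb p' (6 * k) = S ^ k *\<^sub>R p + (e * m ^ k) *\<^sub>R y + c *\<^sub>R w" using vp by blast
    obtain d where d: "velocities r ababcb q (6 * k) = d *\<^sub>R w" using vq by blast
    obtain t where t: "0 \<le> (velocities r ababcb p' (6 * k) + t *\<^sub>R velocities r ababcb q (6 * k)) $ 1"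
      "(velocities r ababcb p' (6 * k) + t *\<^sub>R velocities r ababcb q (6 * k)) $ 2 = 0"
      by (rule generates_gap_signs[OF gen i'])
    have "(c + t * d) * w $ 2 = 0" using t(2) unfolding c d by (simp add: p2 y2 algebra_simps)
    hence cd: "c + t * d = 0" using w2 by simp
    have "0 \<le> S ^ k * p $ 1 + e * m ^ k * y $ 1 + (c + t * d) * w $ 1"
      using t(1) unfolding c d by (simp add: algebra_simps)
    thus ?thesis unfolding cd by simp
  qed
  have "0 < e * - y $ 1" using e y1 by (simp add: mult_pos_neg)
  from power_overtakes[OF _ order(1) this] S
  obtain k where "p $ 1 * S ^ k < (e * - y $ 1) * m ^ k" by blast
  with nonneg[of k] show False by (simp add: algebra_simps)
qed

lemma self_similar_not_stable:
  assumes "self_similar_datum r p q"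
  shows "\<not> stable_datum r p q"
proof -
  have i: "initial_datum p q" using assms by (simp add: self_similar_datum_def)
  obtain l n T \<alpha> \<beta> where "l = S \<and> n = L \<or> l = L \<and> n = S"
    "p = \<alpha> *\<^sub>R explicit_p r l" "q = \<beta> *\<^sub>R explicit_q r l" "mat_M r *v p = n *\<^sub>R p - T *\<^sub>R q"
    by (rule self_similar_form[OF assms])
  thus ?thesis using not_stable_smallest[OF i] not_stable_largest[OF i] by blast
qed

lemma self_similar_iff:
  "self_similar_datum r p q \<longleftrightarrow>
     (\<exists>l \<alpha> \<beta>. (l = L \<or> l = S) \<and> 0 < \<alpha> \<and> 0 < \<beta> \<and>
        p = \<alpha> *\<^sub>R explicit_p r l \<and> q = \<beta> *\<^sub>R explicit_q r l)"
proof
  assume ss: "self_similar_datum r p q"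
  obtain l n T \<alpha> \<beta> where "l = S \<and> n = L \<or> l = L \<and> n = S" "0 < \<alpha>" "0 < \<beta>"
    "p = \<alpha> *\<^sub>R explicit_p r l" "q = \<beta> *\<^sub>R explicit_q r l" "mat_M r *v p = n *\<^sub>R p - T *\<^sub>R q"
    by (rule self_similar_form[OF ss])
  thus "\<exists>l \<alpha> \<beta>. (l = L \<or> l = S) \<and> 0 < \<alpha> \<and> 0 < \<beta> \<and>
        p = \<alpha> *\<^sub>R explicit_p r l \<and> q = \<beta> *\<^sub>R explicit_q r l" by blast
qed (use explicit_self_similar in blast)

end

theorem theorem3p1:
  fixes r :: real
  assumes "0 < r" and "r < 1"
  shows "((\<exists>p q. self_similar_datum r p q) \<longleftrightarrow> r < 5 - 2 * sqrt 6) \<and>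
    (r < 5 - 2 * sqrt 6 \<longrightarrow>
      (\<exists>l. largest_real_eigenvalue (mat_M r) l \<and> 0 < l) \<and>
      (\<exists>l. smallest_real_eigenvalue (mat_M r) l \<and> 0 < l) \<and>
      (\<forall>p q. self_similar_datum r p q \<longleftrightarrow>
        (\<exists>l \<alpha> \<beta>.
          (largest_real_eigenvalue (mat_M r) l \<or> smallest_real_eigenvalue (mat_M r) l) \<and>
          0 < \<alpha> \<and> 0 < \<beta> \<and>
          p = \<alpha> *\<^sub>R explicit_p r l \<and> q = \<beta> *\<^sub>R explicit_q r l)) \<and>
      (\<forall>p q. self_similar_datum r p q \<longrightarrow> \<not> stable_datum r p q))"
proof (cases "0 < threshold r")
  case True
  obtain S m L where "separated_roots r S m L"
    by (rule separated_roots_exist[OF assms True])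
  then interpret separated_roots r S m L .
  have "self_similar_datum r (1 *\<^sub>R explicit_p r L) (1 *\<^sub>R explicit_q r L)"
    by (rule explicit_self_similar) auto
  moreover have "r < 5 - 2 * sqrt 6" using True threshold_pos_iff[OF assms] by simp
  ultimately show ?thesis
    unfolding largest_iff smallest_iff
    using self_similar_iff self_similar_not_stable S order(4) by blast
next
  case False
  thus ?thesis using threshold_pos_iff[OF assms] self_similar_imp_threshold[OF assms] by blast
qed

end
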